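(* Let $I\subset\mathbb{R}$ be an interval with interior $I^{\circ}$, let $\gamma:I\to\mathbb{C}$ be a locally injective analytic curve with image $\gamma^*=\gamma(I)$, let $t_0\in I^{\circ}$, and let $f:\gamma^*\to\mathbb{C}$ be a function which is one sided extendable at $(t_0,\gamma(t_0))$. Let $\Omega$ be the Jordan domain, $t_1,t_2\in I^{\circ}$ the parameters with $t_1<t_0<t_2$ and $\gamma((t_1,t_2))\subset\partial\Omega$, and $F:\Omega\cup\gamma((t_1,t_2))\to\mathbb{C}$ the function extending $f$ as in the definition of one sided extendability (so $F$ is continuous, $F$ is holomorphic in $\Omega$, and $F=f$ on $\gamma((t_1,t_2))$). Define $g:(t_1,t_2)\to\mathbb{C}$ by $g(t)=f(\gamma(t))$ and let $p\in\{1,2,\dots\}\cup\{\infty\}$. Then $g\in C^p((t_1,t_2))$ if and only if $F^{(l)}$ extends continuously to $\Omega\cup\gamma((t_1,t_2))$ for all $l\in\{0,1,2,\dots\}$ with $l\le p$. In this case, for all $t\in(t_1,t_2)$, $$\frac{dg}{dt}(t)=F'(\gamma(t))\cdot\gamma'(t),$$ where $F'(\gamma(t))$ denotes the value at $\gamma(t)$ of the continuous extension of $F'$.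
   Context: A Jordan domain is the bounded domain in $\mathbb{C}$ enclosed by a Jordan curve. An analytic curve $\gamma:I\to\mathbb{C}$ is a real-analytic map of the interval $I$ into $\mathbb{C}$ with $\gamma'(t)\neq 0$ for all $t\in I$. One sided extendability: let $\gamma:I\to\mathbb{C}$ be a locally injective map on an interval $I\subset\mathbb{R}$, $\gamma^*=\gamma(I)$, and $t_0\in I^{\circ}$. A function $f:\gamma^*\to\mathbb{C}$ is one sided extendable at $(t_0,\gamma(t_0))$ if there exist a Jordan domain $\Omega$ whose boundary $\partial\Omega$ contains an arc $\gamma([t_1,t_2])$ of $\gamma^*$, where $t_1,t_2\in I$ and $t_1<t_0<t_2$, and a continuous function $F:\Omega\cup\gamma((t_1,t_2))\to\mathbb{C}$ which is holomorphic in $\Omega$ and satisfies $F|_{\gamma((t_1,t_2))}=f|_{\gamma((t_1,t_2))}$. $F^{(l)}$ denotes the $l$-th complex derivative of $F$ in $\Omega$; $C^p((t_1,t_2))$ is the set of complex-valued functions of class $C^p$ on the real interval $(t_1,t_2)$. *)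

theory Defs
  imports "HOL-Analysis.Analysis"
begin

definition jordan_domain :: "complex set \<Rightarrow> bool" where
  "jordan_domain \<Omega> \<longleftrightarrow>
     (\<exists>c. simple_path c \<and> pathfinish c = pathstart c \<and> \<Omega> = inside (path_image c))"

definition locally_injective_on :: "(real \<Rightarrow> complex) \<Rightarrow> real set \<Rightarrow> bool" where
  "locally_injective_on \<gamma> I \<longleftrightarrow> (\<forall>t\<in>I. \<exists>r>0. inj_on \<gamma> (I \<inter> ball t r))"

(* At an endpoint belonging to I, the power series expansion and the derivative
   are taken relative to I. *)
definition real_analytic_on :: "(real \<Rightarrow> complex) \<Rightarrow> real set \<Rightarrow> bool" where
  "real_analytic_on \<gamma> I \<longleftrightarrow>
     (\<forall>s\<in>I. \<exists>a r. r > 0 \<and>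
        (\<forall>t\<in>I \<inter> ball s r. (\<lambda>n. a n * complex_of_real (t - s) ^ n) sums \<gamma> t))"

definition analytic_curve :: "(real \<Rightarrow> complex) \<Rightarrow> real set \<Rightarrow> bool" where
  "analytic_curve \<gamma> I \<longleftrightarrow>
     real_analytic_on \<gamma> I \<and> (\<forall>t\<in>I. vector_derivative \<gamma> (at t within I) \<noteq> 0)"

(* The data (\<Omega>, t1, t2, F) witness one sided extendability of f.
   Functions are total in HOL: f matters only on the image of \<gamma>, and F only on
   \<Omega> \<union> \<gamma> ` {t1<..<t2}. *)
definition one_sided_extension ::
  "real set \<Rightarrow> (real \<Rightarrow> complex) \<Rightarrow> (complex \<Rightarrow> complex) \<Rightarrow> real \<Rightarrow>
   complex set \<Rightarrow> real \<Rightarrow> real \<Rightarrow> (complex \<Rightarrow> complex) \<Rightarrow> bool" where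
  "one_sided_extension I \<gamma> f t0 \<Omega> t1 t2 F \<longleftrightarrow>
     jordan_domain \<Omega> \<and> t1 \<in> I \<and> t2 \<in> I \<and> t1 < t0 \<and> t0 < t2 \<and>
     \<gamma> ` {t1..t2} \<subseteq> frontier \<Omega> \<and>
     continuous_on (\<Omega> \<union> \<gamma> ` {t1<..<t2}) F \<and>
     F holomorphic_on \<Omega> \<and>
     (\<forall>z\<in>\<gamma> ` {t1<..<t2}. F z = f z)"

definition one_sided_extendable ::
  "real set \<Rightarrow> (real \<Rightarrow> complex) \<Rightarrow> (complex \<Rightarrow> complex) \<Rightarrow> real \<Rightarrow> bool" where
  "one_sided_extendable I \<gamma> f t0 \<longleftrightarrow>
     (\<exists>\<Omega> t1 t2 F. one_sided_extension I \<gamma> f t0 \<Omega> t1 t2 F)"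

definition nth_vector_derivative :: "nat \<Rightarrow> (real \<Rightarrow> complex) \<Rightarrow> real \<Rightarrow> complex" where
  "nth_vector_derivative l g = ((\<lambda>h t. vector_derivative h (at t)) ^^ l) g"

(* Intended for open S: derivatives are two-sided, so only the values of g on S matter. *)
definition Cp_on :: "enat \<Rightarrow> (real \<Rightarrow> complex) \<Rightarrow> real set \<Rightarrow> bool" where
  "Cp_on p g S \<longleftrightarrow>
     (\<forall>l. enat l < p \<longrightarrow> (\<forall>t\<in>S. nth_vector_derivative l g differentiable (at t))) \<and>
     (\<forall>l. enat l \<le> p \<longrightarrow> continuous_on S (nth_vector_derivative l g))"

definition continuous_extension ::
  "complex set \<Rightarrow> complex set \<Rightarrow> (complex \<Rightarrow> complex) \<Rightarrow> (complex \<Rightarrow> complex) \<Rightarrow> bool" where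
  "continuous_extension \<Omega> A h G \<longleftrightarrow> continuous_on A G \<and> (\<forall>z\<in>\<Omega>. G z = h z)"

end

theory Submission
  imports Defs "HOL-Complex_Analysis.Conformal_Mappings"
begin

text \<open>
  The power series of \<open>\<gamma>\<close> at \<open>t\<close> extends \<open>\<gamma>\<close> to a biholomorphic map \<open>\<psi>\<close> near \<open>t\<close>. The arc is relatively
  open in the Jordan curve, so near \<open>\<gamma> t\<close> the boundary of \<open>\<Omega>\<close> is exactly the image of the real axis and,
  by the Jordan curve theorem, exactly one of the two half discs is mapped into \<open>\<Omega>\<close>. Everything thus
  reduces to a function \<open>h\<close> that is holomorphic on a half disc and continuous up to the real axis. If \<open>h'\<close> has
  a limit at a boundary point, the mean value inequality carries over to the boundary and gives
  differentiability there. Conversely, if \<open>h\<close> is \<open>C\<^sup>1\<close> on the real axis, the difference quotients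
  \<open>(h (z + \<delta>) - h z) / \<delta>\<close> converge uniformly on the real axis and differ from \<open>h'\<close> by \<open>O(\<delta> / (Im z)\<^sup>2)\<close>
  inside; the weight \<open>(z\<^sup>2 - \<rho>\<^sup>2)\<^sup>2\<close>, of modulus \<open>4 \<rho>\<^sup>2 (Im z)\<^sup>2\<close> on the circle
  \<open>\<bar>z\<bar> = \<rho>\<close>, absorbs this, and the maximum principle gives uniform convergence up to the boundary.
  The theorem follows by induction on \<open>l\<close>, dividing by \<open>\<gamma>' \<noteq> 0\<close> at every step.
\<close>

section \<open>Holomorphic functions on a half disc\<close>

definition upper_half_disc :: "real \<Rightarrow> complex set" where
  "upper_half_disc r = {z. norm z < r \<and> 0 < Im z}"

lemma mem_upper_half_disc [simp]: "z \<in> upper_half_disc r \<longleftrightarrow> norm z < r \<and> 0 < Im z"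
  by (simp add: upper_half_disc_def)

lemma upper_half_disc_eq: "upper_half_disc r = ball 0 r \<inter> {z. 0 < Im z}"
  by auto

lemma open_upper_half_disc [simp]: "open (upper_half_disc r)"
  unfolding upper_half_disc_eq by (intro open_Int open_ball open_halfspace_Im_gt)

lemma convex_upper_half_disc: "convex (upper_half_disc r)"
  unfolding upper_half_disc_eq by (intro convex_Int convex_ball convex_halfspace_Im_gt)

text \<open>The function \<open>h z - L * z\<close> has small derivative on a small half disc. This
  set is convex, so the mean value inequality holds between its interior points, and vertical limits
  carry it down to the pair \<open>0\<close> and \<open>y\<close> on the real axis.\<close>

lemma has_vector_derivative_of_deriv_limit:
  fixes h :: "complex \<Rightarrow> complex"
  assumes "0 < r"
    and cont: "continuous_on (ball 0 r \<inter> {z. 0 \<le> Im z}) h"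
    and hol: "h holomorphic_on upper_half_disc r"
    and lim: "(deriv h \<longlongrightarrow> L) (at 0 within upper_half_disc r)"
  shows "((\<lambda>x. h (of_real x)) has_vector_derivative L) (at 0)"
  unfolding has_vector_derivative_def has_derivative_at_alt
proof (intro conjI allI impI)
  show "bounded_linear (\<lambda>x. x *\<^sub>R L)"
    by (simp add: bounded_linear_scaleR_left)
  fix e :: real
  assume "0 < e"
  then obtain d where "0 < d"
    and d: "\<And>z. \<lbrakk>z \<in> upper_half_disc r; z \<noteq> 0; dist z 0 < d\<rbrakk> \<Longrightarrow> dist (deriv h z) L < e"
    using lim unfolding Lim_within by auto
  \<comment> \<open>Within radius \<open>s\<close> both the bound on \<open>deriv h z - L\<close>
    and the holomorphy of \<open>h\<close> are available.\<close>
  define s where "s = min d r"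
  have "0 < s" using \<open>0 < d\<close> \<open>0 < r\<close> by (simp add: s_def)
  have bound: "norm (deriv h z - L) \<le> e" if "z \<in> upper_half_disc s" for z
    using d[of z] that by (cases "z = 0") (auto simp: s_def dist_norm)
  have inner: "norm (h z - h w - L * (z - w)) \<le> e * norm (z - w)"
    if "z \<in> upper_half_disc s" "w \<in> upper_half_disc s" for z w
  proof -
    have "norm ((h z - L * z) - (h w - L * w)) \<le> e * norm (z - w)"
    proof (rule field_differentiable_bound[OF convex_upper_half_disc _ bound that])
      fix u assume u: "u \<in> upper_half_disc s"
      then have "(h has_field_derivative deriv h u) (at u)"
        by (intro holomorphic_derivI[OF hol]) (auto simp: s_def)
      then have "((\<lambda>z. h z - L * z) has_field_derivative deriv h u - L) (at u)"
        by (auto intro!: derivative_eq_intros)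
      then show "((\<lambda>z. h z - L * z) has_field_derivative deriv h u - L) (at u within upper_half_disc s)"
        by (rule has_field_derivative_at_within)
    qed
    then show ?thesis by (simp add: algebra_simps)
  qed
  have "norm (h (of_real y) - h 0 - y *\<^sub>R L) \<le> e * \<bar>y\<bar>" if y: "\<bar>y\<bar> < s" for y :: real
  proof -
    \<comment> \<open>Real points are approached vertically from inside the half disc; the closed
      half disc is where \<open>h\<close> is continuous.\<close>
    have vert: "((\<lambda>v::real. h (of_real x + \<i> * of_real v)) \<longlongrightarrow> h (of_real x)) (at_right 0)"
      if "\<bar>x\<bar> < s" for x :: real
    proof -
      have x: "of_real x \<in> ball 0 r \<inter> {z. 0 \<le> Im z}"
        using that by (auto simp: s_def)
      have "((\<lambda>v. of_real x + \<i> * of_real v) \<longlongrightarrow> of_real x + \<i> * of_real 0) (at_right (0::real))"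
        by (intro tendsto_intros)
      then have lim': "((\<lambda>v. of_real x + \<i> * of_real v) \<longlongrightarrow> (of_real x :: complex)) (at_right (0::real))"
        by simp
      have "\<forall>\<^sub>F v in at_right (0::real). of_real x + \<i> * of_real v \<in> ball (0::complex) r"
        using lim' x by (intro topological_tendstoD) auto
      moreover have "\<forall>\<^sub>F v in at_right (0::real). 0 < v"
        by (simp add: eventually_at_right_less)
      ultimately have "\<forall>\<^sub>F v in at_right (0::real).
          of_real x + \<i> * of_real v \<in> ball (0::complex) r \<inter> {z. 0 \<le> Im z}"
        by eventually_elim auto
      then show ?thesis
        by (rule continuous_on_tendsto_compose[OF cont lim' x])
    qed
    have mem: "\<forall>\<^sub>F v in at_right (0::real). of_real x + \<i> * of_real v \<in> upper_half_disc s"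
      if "\<bar>x\<bar> < s" for x :: real
    proof -
      have "((\<lambda>v. of_real x + \<i> * of_real v) \<longlongrightarrow> of_real x + \<i> * of_real 0) (at_right (0::real))"
        by (intro tendsto_intros)
      then have "\<forall>\<^sub>F v in at_right (0::real). of_real x + \<i> * of_real v \<in> ball (0::complex) s"
        using that by (intro topological_tendstoD) auto
      moreover have "\<forall>\<^sub>F v in at_right (0::real). 0 < v"
        by (simp add: eventually_at_right_less)
      ultimately show ?thesis
        by eventually_elim auto
    qed
    \<comment> \<open>Both points are lifted by the same height \<open>v\<close>, so their
      difference remains \<open>y\<close> and the right-hand side of the interior inequality does
      not depend on \<open>v\<close>.\<close>
    have "((\<lambda>v::real. norm (h (of_real y + \<i> * of_real v) - h (of_real 0 + \<i> * of_real v) - y *\<^sub>R L))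
        \<longlongrightarrow> norm (h (of_real y) - h (of_real 0) - y *\<^sub>R L)) (at_right 0)"
      using y \<open>0 < s\<close> by (intro tendsto_intros vert) auto
    moreover have "\<forall>\<^sub>F v in at_right (0::real).
        norm (h (of_real y + \<i> * of_real v) - h (of_real 0 + \<i> * of_real v) - y *\<^sub>R L) \<le> e * \<bar>y\<bar>"
      using mem[OF y] mem[of 0, simplified, OF \<open>0 < s\<close>]
    proof eventually_elim
      case (elim v)
      from inner[OF elim(1), of "\<i> * of_real v"] elim(2) show ?case
        by (simp add: scaleR_conv_of_real mult.commute)
    qed
    ultimately have "norm (h (of_real y) - h (of_real 0) - y *\<^sub>R L) \<le> e * \<bar>y\<bar>"
      by (rule tendsto_upperbound) simp
    then show ?thesis by simp
  qed
  then show "\<exists>d>0. \<forall>y. norm (y - 0) < d \<longrightarrow>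
      norm (h (of_real y) - h (of_real 0) - (y - 0) *\<^sub>R L) \<le> e * norm (y - 0)"
    using \<open>0 < s\<close> by auto
qed

text \<open>The error is at most the oscillation of \<open>g'\<close> on
  \<open>{x..x+\<delta>}\<close>, which uniform continuity on a compact interval makes small for all
  \<open>x\<close> at once. The interval has half-length \<open>2 * \<rho>\<close> so that it
  contains \<open>x + \<delta>\<close> when \<open>\<bar>x\<bar> \<le> \<rho>\<close> and
  \<open>\<delta> < \<rho>\<close>.\<close>

lemma difference_quotients_uniform_limit:
  fixes g g' :: "real \<Rightarrow> complex"
  assumes "0 < \<rho>"
    and der: "\<And>x. \<bar>x\<bar> \<le> 2 * \<rho> \<Longrightarrow> (g has_vector_derivative g' x) (at x)"
    and cont: "continuous_on {-2*\<rho>..2*\<rho>} g'"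
    and "0 < e"
  obtains d where "0 < d" "d \<le> \<rho>"
    "\<And>x \<delta>. \<lbrakk>\<bar>x\<bar> \<le> \<rho>; 0 < \<delta>; \<delta> < d\<rbrakk> \<Longrightarrow> norm ((g (x + \<delta>) - g x) / of_real \<delta> - g' x) \<le> e"
proof -
  have "uniformly_continuous_on {-2*\<rho>..2*\<rho>} g'"
    using cont by (intro compact_uniformly_continuous) auto
  then obtain d where "0 < d" and d: "\<And>x y. \<lbrakk>x \<in> {-2*\<rho>..2*\<rho>}; y \<in> {-2*\<rho>..2*\<rho>}; dist y x < d\<rbrakk> \<Longrightarrow> dist (g' y) (g' x) < e"
    unfolding uniformly_continuous_on_def using \<open>0 < e\<close> by blast
  show thesis
  proof (rule that[of "min d \<rho>"])
    show "0 < min d \<rho>" "min d \<rho> \<le> \<rho>" using \<open>0 < d\<close> \<open>0 < \<rho>\<close> by auto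
  next
    fix x \<delta> :: real assume x: "\<bar>x\<bar> \<le> \<rho>" and \<delta>: "0 < \<delta>" "\<delta> < min d \<rho>"
    have "norm (g (x + \<delta>) - g x - ((x + \<delta>) - x) *\<^sub>R g' x) \<le> norm ((x + \<delta>) - x) * e"
    proof (rule vector_differentiable_bound_linearization[where S = "{x..x+\<delta>}" and f = g and f' = g' and a = x and b = "x + \<delta>"])
      fix y assume y: "y \<in> {x..x+\<delta>}"
      with x \<delta> have "\<bar>y\<bar> \<le> 2 * \<rho>" by (auto simp: abs_le_iff)
      then show "(g has_vector_derivative g' y) (at y within {x..x+\<delta>})"
        by (rule has_vector_derivative_at_within[OF der])
      show "norm (g' y - g' x) \<le> e"
        using d[of x y] x y \<delta> \<open>\<bar>y\<bar> \<le> 2 * \<rho>\<close> by (simp add: dist_norm abs_le_iff)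
    next
      show "closed_segment x (x + \<delta>) \<subseteq> {x..x+\<delta>}" "x \<in> {x..x+\<delta>}"
        using \<delta> by (simp_all add: closed_segment_eq_real_ivl)
    qed
    then have *: "norm (g (x + \<delta>) - g x - of_real \<delta> * g' x) \<le> \<delta> * e"
      using \<delta> by (simp add: scaleR_conv_of_real)
    have "(g (x + \<delta>) - g x) / of_real \<delta> - g' x = (g (x + \<delta>) - g x - of_real \<delta> * g' x) / of_real \<delta>"
      using \<delta> by (simp add: field_simps)
    with * \<delta> show "norm ((g (x + \<delta>) - g x) / of_real \<delta> - g' x) \<le> e"
      by (simp add: norm_divide divide_le_eq mult.commute)
  qed
qed

text \<open>First order Taylor expansion, with the second derivative estimated by Cauchy's
  inequality on discs of radius \<open>Im z / 2\<close>. The step is horizontal, so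
  \<open>Im\<close> is constant on the segment and one radius serves all its points. The segment
  stays within norm \<open>2 * \<rho>\<close> and the discs within
  \<open>3 * \<rho>\<close>.\<close>

lemma difference_quotient_interior_bound:
  fixes h :: "complex \<Rightarrow> complex"
  assumes hol: "h holomorphic_on upper_half_disc (5 * \<rho>)"
    and M: "\<And>w. \<lbrakk>norm w \<le> 4 * \<rho>; 0 < Im w\<rbrakk> \<Longrightarrow> norm (h w) \<le> M"
    and z: "norm z \<le> \<rho>" "0 < Im z" and \<delta>: "0 < \<delta>" "\<delta> \<le> \<rho>"
  shows "norm ((h (z + of_real \<delta>) - h z) / of_real \<delta> - deriv h z) \<le> 8 * M * \<delta> / (Im z)^2"
proof -
  let ?y = "Im z"
  have "0 < \<rho>" using \<delta> by simp
  have second: "norm ((deriv ^^ 2) h w) \<le> 8 * M / ?y^2" if w: "norm w \<le> 2 * \<rho>" "Im w = ?y" for w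
  proof -
    have "?y \<le> 2 * \<rho>"
      using w abs_Im_le_cmod[of w] by linarith
    have sub: "norm u \<le> 3 * \<rho> \<and> 0 < Im u" if "u \<in> cball w (?y / 2)" for u
    proof
      have *: "norm (u - w) \<le> ?y / 2"
        using that by (simp add: dist_norm norm_minus_commute)
      then show "norm u \<le> 3 * \<rho>"
        using norm_triangle_sub[of u w] w \<open>?y \<le> 2 * \<rho>\<close> by linarith
      show "0 < Im u"
        using * abs_Im_le_cmod[of "u - w"] w z by simp
    qed
    have sub': "cball w (?y / 2) \<subseteq> upper_half_disc (5 * \<rho>)"
      using sub \<open>0 < \<rho>\<close> by fastforce
    \<comment> \<open>The constant 8 arises here as \<open>fact 2\<close> times the 4 from squaring
      the halved radius.\<close>
    have "norm ((deriv ^^ 2) h w) \<le> fact 2 * M / (?y / 2)^2"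
    proof (rule Cauchy_inequality)
      show "h holomorphic_on ball w (?y / 2)"
        using hol sub' ball_subset_cball by (metis holomorphic_on_subset order_trans)
      show "continuous_on (cball w (?y / 2)) h"
        using hol sub' by (metis continuous_on_subset holomorphic_on_imp_continuous_on)
      show "norm (h x) \<le> M" if "norm (w - x) = ?y / 2" for x
        using that sub[of x] M[of x] \<open>0 < \<rho>\<close> by (auto simp: dist_norm)
    qed (use z in simp)
    then show ?thesis by (simp add: power_divide)
  qed
  let ?S = "closed_segment z (z + of_real \<delta>)"
  have S: "norm w \<le> 2 * \<rho> \<and> Im w = ?y" if mem: "w \<in> ?S" for w
  proof -
    obtain u where "0 \<le> u" "u \<le> 1" and u: "w = (1 - u) *\<^sub>R z + u *\<^sub>R (z + of_real \<delta>)"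
      using mem unfolding in_segment by blast
    from u have w: "w = z + of_real (u * \<delta>)"
      by (simp add: scaleR_conv_of_real algebra_simps)
    have "u * \<delta> \<le> \<rho>"
      using mult_left_le_one_le[of \<delta> u] \<open>0 \<le> u\<close> \<open>u \<le> 1\<close> \<delta> by linarith
    moreover have "norm w \<le> norm z + u * \<delta>"
      unfolding w using norm_triangle_ineq[of z "of_real (u * \<delta>)"] \<open>0 \<le> u\<close> \<delta>
      by (simp add: norm_mult)
    ultimately show ?thesis
      using z by (simp add: w)
  qed
  \<comment> \<open>The remainder is divided by \<open>fact 1\<close> rather than
    \<open>fact 2\<close>, so the constant 8 is not halved.\<close>
  have "norm ((deriv ^^ 0) h (z + of_real \<delta>) -
      (\<Sum>i\<le>1. (deriv ^^ i) h z * ((z + of_real \<delta>) - z) ^ i / fact i))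
      \<le> 8 * M / ?y^2 * norm ((z + of_real \<delta>) - z) ^ Suc 1 / fact 1"
  proof (rule complex_Taylor[where S = ?S and n = 1 and w = z and z = "z + of_real \<delta>" and B = "8 * M / ?y^2" and f = "\<lambda>i. (deriv ^^ i) h"])
    fix i w assume "w \<in> ?S"
    then have "w \<in> upper_half_disc (5 * \<rho>)"
      using S[of w] z \<open>0 < \<rho>\<close> by simp
    then have "((deriv ^^ i) h has_field_derivative deriv ((deriv ^^ i) h) w) (at w)"
      by (intro holomorphic_derivI[OF holomorphic_higher_deriv[OF hol]]) auto
    then show "((deriv ^^ i) h has_field_derivative (deriv ^^ Suc i) h w) (at w within ?S)"
      by (simp add: has_field_derivative_at_within)
  next
    show "norm ((deriv ^^ Suc 1) h w) \<le> 8 * M / ?y^2" if "w \<in> ?S" for w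
      using second S[OF that] by (simp add: numeral_2_eq_2)
  qed simp_all
  then have *: "norm (h (z + of_real \<delta>) - h z - deriv h z * of_real \<delta>) \<le> 8 * M / ?y^2 * \<delta>^2"
    by (simp add: diff_diff_eq power2_eq_square)
  have "(h (z + of_real \<delta>) - h z) / of_real \<delta> - deriv h z
      = (h (z + of_real \<delta>) - h z - deriv h z * of_real \<delta>) / of_real \<delta>"
    using \<delta> by (simp add: field_simps)
  then have "norm ((h (z + of_real \<delta>) - h z) / of_real \<delta> - deriv h z)
      = norm (h (z + of_real \<delta>) - h z - deriv h z * of_real \<delta>) / \<delta>"
    using \<delta> by (simp add: norm_divide)
  also have "\<dots> \<le> (8 * M / ?y^2 * \<delta>^2) / \<delta>"
    using * \<delta> by (intro divide_right_mono) auto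
  also have "\<dots> = 8 * M * \<delta> / ?y^2"
    using \<delta> by (simp add: power2_eq_square)
  finally show ?thesis .
qed

text \<open>The weighted difference quotients \<open>k n\<close> are uniformly Cauchy on the closed
  half disc \<open>S\<close>, since their differences are small on the arc and on the diameter.
  Their limit \<open>K\<close> is continuous up to \<open>0\<close> and equals the weight times
  \<open>deriv h\<close> inside; the weight is nonzero at \<open>0\<close>, so it can be divided
  out.\<close>

lemma deriv_limit_of_C1_boundary_values:
  fixes h :: "complex \<Rightarrow> complex" and g' :: "real \<Rightarrow> complex"
  assumes "0 < r"
    and cont: "continuous_on (ball 0 r \<inter> {z. 0 \<le> Im z}) h"
    and hol: "h holomorphic_on upper_half_disc r"
    and der: "\<And>x. \<bar>x\<bar> < r \<Longrightarrow> ((\<lambda>x. h (of_real x)) has_vector_derivative g' x) (at x)"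
    and cont': "continuous_on {-r<..<r} g'"
  shows "\<exists>L. (deriv h \<longlongrightarrow> L) (at 0 within upper_half_disc r)"
proof -
  \<comment> \<open>The factor 5 leaves room for every radius in use: \<open>\<rho>\<close> for
    \<open>S\<close>, \<open>2 * \<rho>\<close> for the boundary values, \<open>4 * \<rho>\<close>
    for the bound \<open>M\<close> and \<open>5 * \<rho>\<close> for holomorphy.\<close>
  define \<rho> where "\<rho> = r / 5"
  have \<rho>: "0 < \<rho>" "r = 5 * \<rho>" using \<open>0 < r\<close> by (auto simp: \<rho>_def)
  define S where "S = cball 0 \<rho> \<inter> {z::complex. 0 \<le> Im z}"
  \<comment> \<open>The shift \<open>n + 1\<close> avoids division by zero and keeps every step at
    most \<open>\<rho>\<close>, so that \<open>z + \<delta> n\<close> stays in the domain for all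
    \<open>n\<close>.\<close>
  define \<delta> where "\<delta> n = \<rho> / (real n + 1)" for n
  have \<delta>: "0 < \<delta> n" "\<delta> n \<le> \<rho>" for n
    using \<rho> by (auto simp: \<delta>_def field_simps)
  have \<delta>_lim: "\<delta> \<longlonglongrightarrow> 0"
    unfolding \<delta>_def using LIMSEQ_Suc[OF lim_const_over_n[of \<rho>]] by (simp add: add.commute)
  define q where "q n z = (h (z + of_real (\<delta> n)) - h z) / of_real (\<delta> n)" for n z
  \<comment> \<open>The weight has double zeros at the corners \<rho> and -\<rho>, where the bound
    by \<open>1 / (Im z)^2\<close> on the arc blows up.\<close>
  define k where "k n z = (z^2 - of_real \<rho>^2)^2 * q n z" for n z
  have dom: "z \<in> ball 0 r \<inter> {z. 0 \<le> Im z}" "z + of_real (\<delta> n) \<in> ball 0 r \<inter> {z. 0 \<le> Im z}"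
    if "z \<in> S" for z n
  proof -
    show "z \<in> ball 0 r \<inter> {z. 0 \<le> Im z}"
      using that \<rho> by (auto simp: S_def)
    have "norm (z + of_real (\<delta> n)) \<le> norm z + \<delta> n"
      using norm_triangle_ineq[of z "of_real (\<delta> n)"] \<delta>[of n] by simp
    then show "z + of_real (\<delta> n) \<in> ball 0 r \<inter> {z. 0 \<le> Im z}"
      using that \<rho> \<delta>[of n] by (auto simp: S_def)
  qed
  have "compact (cball 0 (4 * \<rho>) \<inter> {z::complex. 0 \<le> Im z})"
    by (intro compact_Int_closed compact_cball closed_halfspace_Im_ge)
  moreover have "continuous_on (cball 0 (4 * \<rho>) \<inter> {z::complex. 0 \<le> Im z}) h"
    by (rule continuous_on_subset[OF cont]) (use \<rho> in auto)
  ultimately have "bounded (h ` (cball 0 (4 * \<rho>) \<inter> {z::complex. 0 \<le> Im z}))"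
    by (intro compact_imp_bounded compact_continuous_image)
  then obtain M where "0 < M" and M: "\<And>w. \<lbrakk>norm w \<le> 4 * \<rho>; 0 < Im w\<rbrakk> \<Longrightarrow> norm (h w) \<le> M"
    unfolding bounded_pos by fastforce
  have quot: "norm (q n z - deriv h z) \<le> 8 * M * \<delta> n / (Im z)^2"
    if "norm z \<le> \<rho>" "0 < Im z" for n z
    unfolding q_def using difference_quotient_interior_bound[OF _ M that \<delta>] hol \<rho>(2) by simp
  have k_cont: "continuous_on S (k n)" for n
  proof -
    have "continuous_on S h"
      by (rule continuous_on_subset[OF cont]) (use dom in blast)
    moreover have "continuous_on S (\<lambda>z. h (z + of_real (\<delta> n)))"
      by (rule continuous_on_compose2[OF cont]) (use dom(2) in \<open>auto intro!: continuous_intros\<close>)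
    ultimately show ?thesis
      unfolding k_def q_def using \<delta>[of n] by (intro continuous_intros) auto
  qed
  have k_hol: "k n holomorphic_on upper_half_disc \<rho>" for n
  proof -
    have sub: "upper_half_disc \<rho> \<subseteq> S" by (auto simp: S_def)
    have "h holomorphic_on upper_half_disc \<rho>"
      by (rule holomorphic_on_subset[OF hol]) (use \<rho> in auto)
    moreover have "(h \<circ> (\<lambda>z. z + of_real (\<delta> n))) holomorphic_on upper_half_disc \<rho>"
    proof (rule holomorphic_on_compose_gen[OF _ hol])
      show "(\<lambda>z. z + of_real (\<delta> n)) ` upper_half_disc \<rho> \<subseteq> upper_half_disc r"
        using dom(2) sub by fastforce
    qed (intro holomorphic_intros)
    ultimately show ?thesis
      unfolding k_def q_def o_def using \<delta>[of n] by (intro holomorphic_intros) auto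
  qed
  have arc_bound: "norm (k m z - k n z) \<le> 32 * \<rho>^2 * M * (\<delta> m + \<delta> n)"
    if "norm z = \<rho>" "0 < Im z" for m n z
  proof -
    let ?y = "Im z"
    \<comment> \<open>On the circle \<rho>^2 is \<open>z * cnj z\<close>, so the difference factors
      as \<open>z * (z - cnj z)\<close>.\<close>
    have "z^2 - of_real \<rho>^2 = 2 * \<i> * of_real ?y * z"
    proof -
      have "of_real \<rho>^2 = z * cnj z"
        using complex_norm_square[of z] that by simp
      then have "z^2 - of_real \<rho>^2 = z * (z - cnj z)"
        by (simp add: power2_eq_square right_diff_distrib)
      then show ?thesis
        by (simp add: complex_diff_cnj)
    qed
    then have weight: "norm ((z^2 - of_real \<rho>^2)^2) = 4 * ?y^2 * \<rho>^2"
      using that by (simp add: norm_mult norm_power power_mult_distrib)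
    have "norm (q m z - q n z) \<le> norm (q m z - deriv h z) + norm (q n z - deriv h z)"
      using norm_triangle_ineq4[of "q m z - deriv h z" "q n z - deriv h z"] by simp
    also have "\<dots> \<le> 8 * M * (\<delta> m + \<delta> n) / ?y^2"
      using quot[of z m] quot[of z n] that by (simp add: add_divide_distrib distrib_left)
    finally have *: "norm (q m z - q n z) \<le> 8 * M * (\<delta> m + \<delta> n) / ?y^2" .
    have "norm (k m z - k n z) = 4 * ?y^2 * \<rho>^2 * norm (q m z - q n z)"
      unfolding k_def weight[symmetric] by (simp add: norm_mult flip: right_diff_distrib)
    also have "\<dots> \<le> 4 * ?y^2 * \<rho>^2 * (8 * M * (\<delta> m + \<delta> n) / ?y^2)"
      by (intro mult_left_mono *) auto
    also have "\<dots> = 32 * \<rho>^2 * M * (\<delta> m + \<delta> n)"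
      using that by simp
    finally show ?thesis .
  qed
  have "uniformly_Cauchy_on S k"
    unfolding uniformly_Cauchy_on_def
  proof (intro allI impI)
    fix e :: real assume "0 < e"
    \<comment> \<open>On the diameter the weight is at most \<open>\<rho>^4\<close> and two
      quotients each deviate from \<open>g'\<close> by at most \<open>e'\<close>, which adds up to
      \<open>2 * e' * \<rho>^4 = e / 2\<close>.\<close>
    define e' where "e' = e / (4 * \<rho>^4)"
    have "0 < e'" using \<open>0 < e\<close> \<rho> by (simp add: e'_def)
    obtain d where "0 < d" and d: "\<And>x \<delta>. \<lbrakk>\<bar>x\<bar> \<le> \<rho>; 0 < \<delta>; \<delta> < d\<rbrakk> \<Longrightarrow>
        norm ((h (of_real (x + \<delta>)) - h (of_real x)) / of_real \<delta> - g' x) \<le> e'"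
    proof (rule difference_quotients_uniform_limit[OF \<rho>(1) _ _ \<open>0 < e'\<close>, of "\<lambda>x. h (of_real x)" g'])
      show "((\<lambda>x. h (of_real x)) has_vector_derivative g' x) (at x)" if "\<bar>x\<bar> \<le> 2 * \<rho>" for x
        using that \<rho> by (intro der) auto
      show "continuous_on {- 2 * \<rho>..2 * \<rho>} g'"
        by (rule continuous_on_subset[OF cont']) (use \<rho> in auto)
    qed blast
    \<comment> \<open>With both steps below \<open>e / (128 * \<rho>^2 * M)\<close>, the bound
      \<open>arc_bound\<close> becomes \<open>64 / 128\<close> of \<open>e\<close>, that is
      \<open>e / 2\<close>.\<close>
    define d' where "d' = min d (e / (128 * \<rho>^2 * M))"
    have "0 < d'" using \<open>0 < d\<close> \<open>0 < e\<close> \<open>0 < M\<close> \<rho> by (simp add: d'_def)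
    then obtain N where N: "\<And>n. n \<ge> N \<Longrightarrow> \<delta> n < d'"
      using order_tendstoD(2)[OF \<delta>_lim] unfolding eventually_sequentially by blast
    show "\<exists>N. \<forall>x\<in>S. \<forall>m\<ge>N. \<forall>n\<ge>N. dist (k m x) (k n x) < e"
    proof (intro exI[of _ N] ballI allI impI)
      fix z m n assume "z \<in> S" "N \<le> m" "N \<le> n"
      have arc: "norm (k m z - k n z) \<le> e / 2" if "norm z = \<rho>" "0 < Im z" for z
      proof -
        have "\<delta> m + \<delta> n \<le> 2 * (e / (128 * \<rho>^2 * M))"
          using N[OF \<open>N \<le> m\<close>] N[OF \<open>N \<le> n\<close>] unfolding d'_def by linarith
        then have "32 * \<rho>^2 * M * (\<delta> m + \<delta> n) \<le> 32 * \<rho>^2 * M * (2 * (e / (128 * \<rho>^2 * M)))"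
          using \<open>0 < M\<close> by (intro mult_left_mono) auto
        also have "\<dots> = e / 2"
          using \<open>0 < M\<close> \<rho> by (simp add: field_simps)
        finally show ?thesis
          using arc_bound[OF that, of m n] by linarith
      qed
      have real: "norm (k m z - k n z) \<le> e / 2" if z: "norm z \<le> \<rho>" "Im z = 0" for z
      proof -
        define x where "x = Re z"
        have zx: "z = of_real x" using z by (simp add: x_def complex_eq_iff)
        then have x: "\<bar>x\<bar> \<le> \<rho>" using z by simp
        have qx: "norm (q j z - g' x) \<le> e'" if "j \<ge> N" for j
          using d[OF x \<delta>(1)[of j]] N[OF that] by (simp add: q_def zx d'_def)
        have "norm (q m z - q n z) \<le> norm (q m z - g' x) + norm (q n z - g' x)"
          using norm_triangle_ineq4[of "q m z - g' x" "q n z - g' x"] by simp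
        also have "\<dots> \<le> 2 * e'"
          using qx[OF \<open>N \<le> m\<close>] qx[OF \<open>N \<le> n\<close>] by simp
        finally have *: "norm (q m z - q n z) \<le> 2 * e'" .
        \<comment> \<open>For real \<open>x\<close> in the diameter, \<open>x^2 - \<rho>^2\<close>
          lies between \<open>-\<rho>^2\<close> and 0, which bounds the weight by
          \<open>\<rho>^4\<close>.\<close>
        have "x^2 \<le> \<rho>^2" using x by (simp add: abs_le_square_iff[symmetric] \<rho>(1) less_imp_le)
        then have "(x^2 - \<rho>^2)^2 \<le> (\<rho>^2)^2"
          by (intro abs_le_square_iff[THEN iffD1]) auto
        moreover have "norm ((z^2 - of_real \<rho>^2)^2) = (x^2 - \<rho>^2)^2"
          unfolding zx by (simp add: norm_power flip: of_real_power of_real_diff)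
        ultimately have "norm ((z^2 - of_real \<rho>^2)^2) * norm (q m z - q n z) \<le> \<rho>^4 * (2 * e')"
          using * by (intro mult_mono) auto
        then show ?thesis
          using \<rho> by (simp add: k_def e'_def norm_mult flip: right_diff_distrib)
      qed
      have "norm (k m z - k n z) \<le> e / 2"
      proof (cases "norm z < \<rho> \<and> 0 < Im z")
        case True
        show ?thesis
        proof (rule maximum_modulus_frontier[where S = "upper_half_disc \<rho>" and f = "\<lambda>z. k m z - k n z"])
          have cl: "closure (upper_half_disc \<rho>) \<subseteq> S"
          proof (rule closure_minimal)
            show "closed S"
              unfolding S_def by (intro closed_Int closed_cball closed_halfspace_Im_ge)
          qed (auto simp: S_def)
          show "(\<lambda>z. k m z - k n z) holomorphic_on interior (upper_half_disc \<rho>)"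
            by (simp add: interior_open) (intro holomorphic_intros k_hol)
          show "continuous_on (closure (upper_half_disc \<rho>)) (\<lambda>z. k m z - k n z)"
            by (rule continuous_on_subset[OF _ cl]) (intro continuous_intros k_cont)
          show "bounded (upper_half_disc \<rho>)"
            unfolding upper_half_disc_eq by (simp add: bounded_Int)
          \<comment> \<open>A frontier point lies in \<open>S\<close> outside the open half disc,
            hence on the open arc or on the closed diameter; the two corners count as points of the
            diameter.\<close>
          show "norm (k m w - k n w) \<le> e / 2" if "w \<in> frontier (upper_half_disc \<rho>)" for w
          proof -
            have "w \<in> S" "w \<notin> upper_half_disc \<rho>"
              using that cl by (auto simp: frontier_def interior_open)
            then consider "norm w = \<rho>" "0 < Im w" | "norm w \<le> \<rho>" "Im w = 0"
              by (fastforce simp: S_def)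
            then show ?thesis using arc real by cases auto
          qed
          show "z \<in> upper_half_disc \<rho>" using True by simp
        qed
      next
        case False
        with \<open>z \<in> S\<close> consider "norm z = \<rho>" "0 < Im z" | "norm z \<le> \<rho>" "Im z = 0"
          by (fastforce simp: S_def)
        then show ?thesis using arc real by cases auto
      qed
      then show "dist (k m z) (k n z) < e"
        using \<open>0 < e\<close> by (simp add: dist_norm)
    qed
  qed
  then obtain K where K: "uniform_limit S k K sequentially"
    using Cauchy_uniformly_convergent uniformly_convergent_on_def by blast
  have K_cont: "continuous_on S K"
    by (rule uniform_limit_theorem[OF _ K]) (simp_all add: k_cont)
  \<comment> \<open>At a fixed interior point \<open>Im z\<close> is a positive constant, so
    \<open>quot\<close> forces the unweighted quotients to converge to
    \<open>deriv h z\<close>.\<close>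
  have K_eq: "K z = (z^2 - of_real \<rho>^2)^2 * deriv h z" if "z \<in> upper_half_disc \<rho>" for z
  proof (rule LIMSEQ_unique)
    show "(\<lambda>n. k n z) \<longlonglongrightarrow> K z"
      by (rule tendsto_uniform_limitI[OF K]) (use that in \<open>auto simp: S_def\<close>)
    have bd: "\<forall>\<^sub>F n in sequentially. norm (q n z - deriv h z) \<le> 8 * M * \<delta> n / (Im z)^2"
      using quot[of z] that by simp
    have "(\<lambda>n. 8 * M * \<delta> n / (Im z)^2) \<longlonglongrightarrow> 8 * M * 0 / (Im z)^2"
      by (intro tendsto_intros \<delta>_lim) (use that in auto)
    then have "(\<lambda>n. 8 * M * \<delta> n / (Im z)^2) \<longlonglongrightarrow> 0"
      by simp
    with bd have "(\<lambda>n. q n z - deriv h z) \<longlonglongrightarrow> 0"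
      by (rule Lim_null_comparison)
    then have "(\<lambda>n. q n z) \<longlonglongrightarrow> deriv h z"
      by (simp add: LIM_zero_iff)
    then show "(\<lambda>n. k n z) \<longlonglongrightarrow> (z^2 - of_real \<rho>^2)^2 * deriv h z"
      unfolding k_def by (intro tendsto_intros)
  qed
  have "(K \<longlongrightarrow> K 0) (at 0 within S)"
    using K_cont \<rho> by (simp add: continuous_on_def S_def)
  then have "(K \<longlongrightarrow> K 0) (at 0 within upper_half_disc \<rho>)"
    by (rule tendsto_within_subset) (auto simp: S_def)
  then have "((\<lambda>z. K z / (z^2 - of_real \<rho>^2)^2) \<longlongrightarrow> K 0 / (0^2 - of_real \<rho>^2)^2) (at 0 within upper_half_disc \<rho>)"
    by (intro tendsto_intros) (use \<rho> in auto)
  moreover have "\<forall>\<^sub>F z in at 0 within upper_half_disc \<rho>. K z / (z^2 - of_real \<rho>^2)^2 = deriv h z"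
  proof -
    have "K z / (z^2 - of_real \<rho>^2)^2 = deriv h z" if z: "z \<in> upper_half_disc \<rho>" for z
    proof -
      \<comment> \<open>The zeros of the weight have modulus \<rho>, hence lie outside the open half
        disc.\<close>
      have "z^2 \<noteq> of_real \<rho>^2"
      proof
        assume "z^2 = of_real \<rho>^2"
        then have "norm z ^ 2 = \<rho>^2"
          using \<rho> by (metis norm_of_real norm_power abs_of_pos)
        then show False
          using z \<rho> by (simp add: power2_eq_iff_nonneg)
      qed
      then show "K z / (z^2 - of_real \<rho>^2)^2 = deriv h z"
        using K_eq[OF z] by simp
    qed
    then show ?thesis
      by (simp add: eventually_at_filter)
  qed
  ultimately have "(deriv h \<longlongrightarrow> K 0 / (0^2 - of_real \<rho>^2)^2) (at 0 within upper_half_disc \<rho>)"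
    by (rule Lim_transform_eventually)
  moreover have "at 0 within upper_half_disc \<rho> = at 0 within upper_half_disc r"
    by (rule at_within_nhd[of _ "ball 0 \<rho>"]) (use \<rho> in auto)
  ultimately show ?thesis by auto
qed

section \<open>Analytic boundary arcs\<close>

text \<open>Convergence of a power series at a real point forces convergence in the complex disc up
  to that point. Real analyticity speaks only of points of \<open>I\<close>, so the radius is also
  limited by an interval around \<open>t\<close> contained in \<open>I\<close>.\<close>

lemma real_analytic_on_complexify:
  assumes ana: "real_analytic_on \<gamma> I" and t: "t \<in> interior I"
  obtains r \<phi> where "0 < r" "\<phi> holomorphic_on ball (of_real t) r"
    "\<And>s. \<bar>s - t\<bar> < r \<Longrightarrow> s \<in> I \<and> \<phi> (of_real s) = \<gamma> s"
proof -
  obtain e where "0 < e" and e: "ball t e \<subseteq> I"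
    using t by (auto simp: mem_interior)
  have "t \<in> I" using t interior_subset by blast
  then obtain a R where "0 < R"
    and sums: "\<And>s. s \<in> I \<inter> ball t R \<Longrightarrow> (\<lambda>n. a n * of_real (s - t) ^ n) sums \<gamma> s"
    using ana unfolding real_analytic_on_def by blast
  define r where "r = min R e"
  define \<phi> where "\<phi> w = (\<Sum>n. a n * (w - of_real t) ^ n)" for w :: complex
  have near: "s \<in> I" "s \<in> ball t R" if "\<bar>s - t\<bar> < r" for s
    using that e by (auto simp: r_def dist_real_def abs_minus_commute subset_iff)
  show thesis
  proof (rule that)
    show "0 < r" using \<open>0 < R\<close> \<open>0 < e\<close> by (simp add: r_def)
    show "\<phi> holomorphic_on ball (of_real t) r"
    proof (rule power_series_holomorphic)
      fix w :: complex assume "w \<in> ball (of_real t) r"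
      \<comment> \<open>The real point \<open>t + x\<close> is farther from \<open>t\<close> than
        \<open>w\<close> and still within the radius where the series is known to converge.\<close>
      then obtain x where x: "norm (w - of_real t) < x" "x < r"
        using dense by (auto simp: dist_norm norm_minus_commute)
      then have "0 < x" using norm_ge_zero le_less_trans by blast
      have "summable (\<lambda>n. a n * of_real x ^ n)"
        using sums[of "t + x"] near[of "t + x"] x \<open>0 < x\<close> by (auto simp: sums_iff)
      then have "summable (\<lambda>n. a n * (w - of_real t) ^ n)"
        by (rule powser_inside) (use x \<open>0 < x\<close> in simp)
      then show "(\<lambda>n. a n * (w - of_real t) ^ n) sums \<phi> w"
        unfolding \<phi>_def by (rule summable_sums)
    qed
    show "s \<in> I \<and> \<phi> (of_real s) = \<gamma> s" if "\<bar>s - t\<bar> < r" for s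
      using sums[of s] near[OF that] by (auto simp: \<phi>_def sums_iff)
  qed
qed

text \<open>A Jordan curve minus one point is homeomorphic to the real line, where a continuous
  injective image of an open interval is open. The point removed is the endpoint \<open>u a\<close>,
  which injectivity keeps out of the open arc.\<close>

lemma openin_arc_of_simple_closed_path:
  fixes c u :: "real \<Rightarrow> complex"
  assumes c: "simple_path c" "pathfinish c = pathstart c"
    and cont: "continuous_on {a..b} u" and inj: "inj_on u {a..b}"
    and sub: "u ` {a..b} \<subseteq> path_image c" and "a < b"
  shows "openin (top_of_set (path_image c)) (u ` {a<..<b})"
proof -
  obtain f g where fg: "homeomorphism (path_image c) (sphere (0::complex) 1) f g"
    using homeomorphic_simple_path_image_circle[OF c, of 1 0] unfolding homeomorphic_def by auto
  have ua: "u a \<in> path_image c" using sub \<open>a < b\<close> by auto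
  have inj_f: "inj_on f (path_image c)"
    using fg by (metis homeomorphism_def inj_on_inverseI)
  have f_ua: "f (u a) \<in> sphere 0 1"
    using fg ua by (auto simp: homeomorphism_def)
  have "homeomorphism (path_image c - {u a}) (sphere 0 1 - {f (u a)}) f g"
    using fg by (rule homeomorphism_of_subsets)
      (use ua inj_f homeomorphism_image1[OF fg] in \<open>auto simp: inj_on_image_set_diff[OF inj_f]\<close>)
  moreover have "(sphere 0 1 - {f (u a)}) homeomorphic (UNIV :: real set)"
    by (rule homeomorphic_punctured_sphere_affine) (use f_ua in auto)
  ultimately have "(path_image c - {u a}) homeomorphic (UNIV :: real set)"
    using homeomorphic_trans unfolding homeomorphic_def by blast
  then obtain F G where FG: "homeomorphism (path_image c - {u a}) (UNIV :: real set) F G"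
    unfolding homeomorphic_def by blast
  have img: "u ` {a<..<b} \<subseteq> path_image c - {u a}"
  proof (clarify)
    fix x assume "x \<in> {a<..<b}"
    then show "u x \<in> path_image c - {u a}"
      using sub inj_onD[OF inj, of x a] by auto
  qed
  have "open ((F \<circ> u) ` {a<..<b})"
  proof (rule injective_into_1d_imp_open_map_UNIV[OF open_greaterThanLessThan _ _ order_refl])
    show "continuous_on {a<..<b} (F \<circ> u)"
      using img FG by (intro continuous_on_compose continuous_on_subset[OF cont])
        (auto simp: homeomorphism_def elim: continuous_on_subset)
    have "inj_on F (u ` {a<..<b})"
      using img FG by (metis homeomorphism_def inj_on_inverseI inj_on_subset)
    then show "inj_on (F \<circ> u) {a<..<b}"
      by (intro comp_inj_on inj_on_subset[OF inj]) auto
  qed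
  then have "openin (top_of_set (path_image c - {u a})) (G ` (F \<circ> u) ` {a<..<b})"
    using homeomorphism_imp_open_map[OF homeomorphism_symD[OF FG]] by simp
  also have "G ` (F \<circ> u) ` {a<..<b} = (\<lambda>x. G (F (u x))) ` {a<..<b}"
    by (simp add: image_image)
  also have "\<dots> = u ` {a<..<b}"
    using img by (intro image_cong refl homeomorphism_apply1[OF FG]) blast
  \<comment> \<open>The arc is open in the punctured curve, which in turn is open in the whole
    curve.\<close>
  finally show ?thesis
    by (rule openin_trans) (rule openin_delete[OF openin_subtopology_self])
qed

text \<open>Inside and outside are disjoint open sets covering the complement of the curve, so a
  connected set off the curve cannot meet both.\<close>

lemma connected_subset_inside_or_outside:
  fixes c :: "real \<Rightarrow> complex"
  assumes "simple_path c" "pathfinish c = pathstart c"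
    and "connected C" "C \<inter> path_image c = {}"
  shows "C \<subseteq> inside (path_image c) \<or> C \<subseteq> outside (path_image c)"
proof -
  note J = Jordan_inside_outside[OF assms(1,2)]
  have "C \<subseteq> inside (path_image c) \<union> outside (path_image c)"
    using J assms(4) by blast
  then have "inside (path_image c) \<inter> C = {} \<or> outside (path_image c) \<inter> C = {}"
    using J by (intro connectedD[OF \<open>connected C\<close>]) auto
  then show ?thesis
    using \<open>C \<subseteq> inside (path_image c) \<union> outside (path_image c)\<close> by blast
qed

text \<open>The curve may run with \<open>\<Omega>\<close> on its left or on its right. The sign
  \<sigma> absorbs this: it reverses the parameter if necessary, so that the upper half disc is
  always the one mapped into \<open>\<Omega>\<close>.\<close>

lemma analytic_curve_boundary_chart:
  assumes I: "is_interval I" "t1 \<in> I" "t2 \<in> I"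
    and curve: "analytic_curve \<gamma> I"
    and \<Omega>: "jordan_domain \<Omega>" "\<gamma> ` {t1..t2} \<subseteq> frontier \<Omega>"
    and t: "t \<in> {t1<..<t2}"
  obtains r \<psi> \<sigma> where "0 < r" "\<sigma> \<in> {1, -1 :: real}"
    "\<psi> holomorphic_on ball 0 r" "inj_on \<psi> (ball 0 r)"
    "(\<psi> has_field_derivative of_real \<sigma> * vector_derivative \<gamma> (at t)) (at 0)"
    "\<And>x. \<bar>x\<bar> < r \<Longrightarrow> t + \<sigma> * x \<in> {t1<..<t2} \<and> \<psi> (of_real x) = \<gamma> (t + \<sigma> * x)"
    "\<And>z. z \<in> ball 0 r \<Longrightarrow> \<psi> z \<in> \<Omega> \<longleftrightarrow> 0 < Im z"
proof -
  obtain c where c: "simple_path c" "pathfinish c = pathstart c" and \<Omega>_eq: "\<Omega> = inside (path_image c)"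
    using \<Omega>(1) unfolding jordan_domain_def by blast
  note J = Jordan_inside_outside[OF c]
  have front: "frontier \<Omega> = path_image c" using J \<Omega>_eq by simp
  have "{t1..t2} \<subseteq> I"
    using mem_is_interval_1_I[OF I] by auto
  then have t_int: "t \<in> interior I"
    using t by (intro interiorI[of "{t1<..<t2}"]) fastforce+
  obtain r0 \<phi> where "0 < r0" and \<phi>_hol: "\<phi> holomorphic_on ball (of_real t) r0"
    and \<phi>: "\<And>s. \<bar>s - t\<bar> < r0 \<Longrightarrow> s \<in> I \<and> \<phi> (of_real s) = \<gamma> s"
    using real_analytic_on_complexify[OF _ t_int] curve unfolding analytic_curve_def by metis
  have \<phi>_der: "(\<phi> has_field_derivative deriv \<phi> (of_real t)) (at (of_real t))"
    using \<open>0 < r0\<close> by (intro holomorphic_derivI[OF \<phi>_hol]) auto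
  have "((\<lambda>s. \<phi> (of_real s)) has_vector_derivative deriv \<phi> (of_real t)) (at t)"
    using \<phi>_der by (rule has_vector_derivative_real_field)
  then have \<gamma>_der: "(\<gamma> has_vector_derivative deriv \<phi> (of_real t)) (at t)"
    by (rule has_vector_derivative_transform_within_open[of _ _ _ "ball t r0"])
      (use \<open>0 < r0\<close> \<phi> in \<open>auto simp: dist_real_def abs_minus_commute\<close>)
  then have deriv_eq: "deriv \<phi> (of_real t) = vector_derivative \<gamma> (at t)"
    by (simp add: vector_derivative_at)
  have "vector_derivative \<gamma> (at t within I) \<noteq> 0"
    using curve t_int interior_subset unfolding analytic_curve_def by blast
  then have dnz: "deriv \<phi> (of_real t) \<noteq> 0"
    unfolding deriv_eq at_within_interior[OF t_int] .
  have "complex_of_real t \<in> ball (of_real t) r0" using \<open>0 < r0\<close> by simp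
  then obtain r1 where "0 < r1" and r1: "ball (complex_of_real t) r1 \<subseteq> ball (of_real t) r0"
    "inj_on \<phi> (ball (of_real t) r1)"
    by (rule has_complex_derivative_locally_injective[OF \<phi>_hol _ open_ball dnz])
  \<comment> \<open>Halving makes the closed interval of radius \<open>r2\<close> fit strictly
    inside both \<open>{t1<..<t2}\<close> and the disc on which \<phi> is injective.\<close>
  define r2 where "r2 = min r1 (min (t - t1) (t2 - t)) / 2"
  have "0 < r2" "r2 < r1" and r2_sub: "{t-r2..t+r2} \<subseteq> {t1<..<t2}"
    using t \<open>0 < r1\<close> by (auto simp: r2_def min_def field_simps split: if_splits)
  have in_ball: "of_real s \<in> ball (of_real t :: complex) r1" if "\<bar>s - t\<bar> \<le> r2" for s
    using that \<open>r2 < r1\<close> by (simp add: dist_of_real dist_real_def abs_minus_commute)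
  have \<phi>_eq: "\<phi> (of_real s) = \<gamma> s" if "\<bar>s - t\<bar> \<le> r2" for s
  proof (rule \<phi>[THEN conjunct2])
    have "complex_of_real s \<in> ball (of_real t) r0"
      using in_ball[OF that] r1 by blast
    then show "\<bar>s - t\<bar> < r0"
      by (simp add: dist_of_real dist_real_def abs_minus_commute)
  qed
  \<comment> \<open>Near \<open>t\<close> this is \<gamma>, but written through \<phi>, from which
    it inherits continuity and injectivity.\<close>
  define u where "u s = \<phi> (of_real s)" for s
  have u_eq: "u s = \<gamma> s" if "s \<in> {t-r2..t+r2}" for s
    unfolding u_def by (rule \<phi>_eq) (use that in auto)
  have on_J: "\<gamma> s \<in> path_image c" if "s \<in> {t1<..<t2}" for s
    using \<Omega>(2) that front by auto
  have "openin (top_of_set (path_image c)) (u ` {t-r2<..<t+r2})"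
  proof (rule openin_arc_of_simple_closed_path[OF c])
    show "continuous_on {t-r2..t+r2} u"
      unfolding u_def
    proof (rule continuous_on_compose2[of _ \<phi> _ of_real])
      show "continuous_on (ball (of_real t) r1) \<phi>"
        using \<phi>_hol r1 by (meson holomorphic_on_imp_continuous_on continuous_on_subset)
    qed (use in_ball in \<open>auto intro!: continuous_intros\<close>)
    have "inj_on \<phi> (of_real ` {t-r2..t+r2})"
      by (rule inj_on_subset[OF r1(2)]) (use in_ball in auto)
    moreover have "inj_on (of_real :: real \<Rightarrow> complex) {t-r2..t+r2}"
      by (simp add: inj_on_def)
    ultimately show "inj_on u {t-r2..t+r2}"
      unfolding u_def using comp_inj_on[of of_real "{t-r2..t+r2}" \<phi>] by (simp add: o_def)
    show "u ` {t-r2..t+r2} \<subseteq> path_image c"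
      using u_eq on_J r2_sub by auto
  qed (use \<open>0 < r2\<close> in auto)
  \<comment> \<open>Inside \<open>W\<close> the Jordan curve consists of the small arc only; no
    other portion of the curve comes near \<open>\<gamma> t\<close>.\<close>
  then obtain W where "open W" and W: "u ` {t-r2<..<t+r2} = path_image c \<inter> W"
    by (auto simp: openin_open)
  have "u t \<in> W" using W \<open>0 < r2\<close> by auto
  have "isCont \<phi> (of_real t)"
    using \<phi>_der by (rule DERIV_isCont)
  then have "\<forall>\<^sub>F z in nhds (of_real t). \<phi> z \<in> W"
    using \<open>open W\<close> \<open>u t \<in> W\<close> unfolding u_def isCont_def by (metis eventually_nhds_conv_at topological_tendstoD)
  then obtain d where "0 < d" and d: "\<And>z. dist z (of_real t) < d \<Longrightarrow> \<phi> z \<in> W"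
    unfolding eventually_nhds_metric by blast
  define r where "r = min d r2"
  have "0 < r" using \<open>0 < d\<close> \<open>0 < r2\<close> by (simp add: r_def)
  define \<psi> where "\<psi> z = \<phi> (of_real t + z)" for z
  have shift: "of_real t + z \<in> ball (of_real t) r1" if "z \<in> ball 0 r" for z :: complex
    using that \<open>r2 < r1\<close> by (simp add: dist_norm r_def)
  have \<psi>_hol: "\<psi> holomorphic_on ball 0 r"
  proof -
    have sub: "(\<lambda>z. of_real t + z) ` ball 0 r \<subseteq> ball (of_real t :: complex) r0"
      using shift r1(1) by blast
    have "(\<phi> \<circ> (\<lambda>z. of_real t + z)) holomorphic_on ball 0 r"
      by (rule holomorphic_on_compose_gen[OF _ \<phi>_hol sub]) (intro holomorphic_intros)
    then show ?thesis by (simp add: \<psi>_def[abs_def] o_def)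
  qed
  have \<psi>_inj: "inj_on \<psi> (ball 0 r)"
  proof (rule inj_onI)
    fix z w assume z: "z \<in> ball 0 r" and w: "w \<in> ball 0 r" and eq: "\<psi> z = \<psi> w"
    have "of_real t + z = of_real t + w"
      by (rule inj_onD[OF r1(2) eq[unfolded \<psi>_def] shift[OF z] shift[OF w]])
    then show "z = w" by simp
  qed
  \<comment> \<open>A point of the curve in \<open>W\<close> is \<open>u s\<close> for some real
    \<open>s\<close>, and injectivity of \<phi> then identifies \<open>z\<close> with
    \<open>s - t\<close>.\<close>
  have \<psi>_J: "\<psi> z \<in> path_image c \<longleftrightarrow> Im z = 0" if z: "z \<in> ball 0 r" for z
  proof
    assume "\<psi> z \<in> path_image c"
    moreover have "\<psi> z \<in> W"
      using z unfolding \<psi>_def by (intro d) (simp add: dist_norm r_def)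
    ultimately obtain s where s: "s \<in> {t-r2<..<t+r2}" "\<psi> z = u s"
      using W by blast
    have "of_real t + z = of_real s"
    proof (rule inj_onD[OF r1(2) _ shift[OF z] in_ball])
      show "\<phi> (of_real t + z) = \<phi> (of_real s)"
        using s(2) by (simp add: \<psi>_def u_def)
    qed (use s(1) in auto)
    then show "Im z = 0"
      by (metis Im_complex_of_real add_0 plus_complex.simps(2))
  next
    assume "Im z = 0"
    then have z_eq: "z = of_real (Re z)" by (simp add: complex_eq_iff)
    from \<open>Im z = 0\<close> have "\<bar>Re z\<bar> < r2" using z by (auto simp: cmod_eq_Re r_def)
    then have mem: "t + Re z \<in> {t-r2..t+r2}" by auto
    have "\<psi> z = u (t + Re z)"
      unfolding \<psi>_def u_def by (subst z_eq) simp
    then show "\<psi> z \<in> path_image c"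
      using u_eq[OF mem] on_J[OF subsetD[OF r2_sub mem]] by simp
  qed
  define U where "U = upper_half_disc r"
  \<comment> \<open>Multiplication by -1 carries the upper half disc onto the lower one, so
    \<open>D 1\<close> and \<open>D (-1)\<close> are the images of the two halves.\<close>
  define D where "D \<sigma> = \<psi> ` (\<lambda>z. of_real \<sigma> * z) ` U" for \<sigma> :: real
  have \<psi>_cont: "continuous_on (ball 0 r) \<psi>"
    using \<psi>_hol by (rule holomorphic_on_imp_continuous_on)
  have side: "D \<sigma> \<subseteq> inside (path_image c) \<or> D \<sigma> \<subseteq> outside (path_image c)" if "\<sigma> \<in> {1, -1}" for \<sigma>
  proof (rule connected_subset_inside_or_outside[OF c])
    have sub: "(\<lambda>z. of_real \<sigma> * z) ` U \<subseteq> ball 0 r"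
      using that by (auto simp: U_def)
    show "connected (D \<sigma>)"
      unfolding D_def U_def
      by (intro connected_continuous_image continuous_on_subset[OF \<psi>_cont] continuous_intros
          convex_connected convex_upper_half_disc sub[unfolded U_def])
    show "D \<sigma> \<inter> path_image c = {}"
      using \<psi>_J sub that by (force simp: D_def U_def)
  qed
  have ball_split: "\<psi> z \<in> path_image c \<union> D 1 \<union> D (-1)" if "z \<in> ball 0 r" for z
  proof (cases "Im z" "0 :: real" rule: linorder_cases)
    case less
    then have "- z \<in> U" using that by (simp add: U_def)
    then have "\<psi> z \<in> D (-1)" unfolding D_def by force
    then show ?thesis by blast
  next
    case equal
    then show ?thesis using \<psi>_J[OF that] by blast
  next
    case greater
    then have "z \<in> U" using that by (simp add: U_def)
    then have "\<psi> z \<in> D 1" unfolding D_def by force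
    then show ?thesis by blast
  qed
  have "open (\<psi> ` ball 0 r)"
    by (rule open_mapping_thm3[OF \<psi>_hol _ \<psi>_inj]) simp
  moreover have "\<psi> 0 \<in> \<psi> ` ball 0 r" "\<psi> 0 \<in> path_image c"
    using \<open>0 < r\<close> \<psi>_J[of 0] by auto
  ultimately have meets: "\<psi> ` ball 0 r \<inter> S \<noteq> {}" if "frontier S = path_image c" for S
    using that by (metis Int_commute closure_iff_nhds_not_empty frontier_def DiffD1 subset_refl)
  have not_both: "\<not> (D 1 \<subseteq> T \<and> D (-1) \<subseteq> T)"
    if "T \<inter> S = {}" "S \<inter> path_image c = {}" "frontier S = path_image c" for S T
    using meets[OF that(3)] ball_split that by blast
  obtain \<sigma> :: real where \<sigma>: "\<sigma> \<in> {1, -1}" "D \<sigma> \<subseteq> inside (path_image c)" "D (-\<sigma>) \<subseteq> outside (path_image c)"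
  proof -
    have "\<not> (D 1 \<subseteq> inside (path_image c) \<and> D (-1) \<subseteq> inside (path_image c))"
      by (rule not_both[of _ "outside (path_image c)"]) (use J in blast)+
    moreover have "\<not> (D 1 \<subseteq> outside (path_image c) \<and> D (-1) \<subseteq> outside (path_image c))"
      by (rule not_both[of _ "inside (path_image c)"]) (use J in blast)+
    ultimately consider "D 1 \<subseteq> inside (path_image c)" "D (-1) \<subseteq> outside (path_image c)"
      | "D (-1) \<subseteq> inside (path_image c)" "D 1 \<subseteq> outside (path_image c)"
      using side[of 1] side[of "-1"] by auto
    then show ?thesis
      using that[of 1] that[of "-1"] by cases auto
  qed
  have \<sigma>_sq: "of_real \<sigma> * of_real \<sigma> = (1::complex)" "of_real \<sigma> * (of_real \<sigma> * z) = z" for z :: complex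
    using \<sigma>(1) by auto
  have \<sigma>_ball: "of_real \<sigma> * z \<in> ball 0 r" if "z \<in> ball 0 r" for z :: complex
    using that \<sigma>(1) by auto
  show thesis
  proof (rule that)
    show "0 < r" by fact
    show "\<sigma> \<in> {1, -1}" by fact
    have sub: "(\<lambda>z. of_real \<sigma> * z) ` ball 0 r \<subseteq> ball (0::complex) r"
      using \<sigma>_ball by blast
    have "(\<psi> \<circ> (\<lambda>z. of_real \<sigma> * z)) holomorphic_on ball 0 r"
      by (rule holomorphic_on_compose_gen[OF _ \<psi>_hol sub]) (intro holomorphic_intros)
    then show "(\<lambda>z. \<psi> (of_real \<sigma> * z)) holomorphic_on ball 0 r"
      by (simp add: o_def)
    show "inj_on (\<lambda>z. \<psi> (of_real \<sigma> * z)) (ball 0 r)"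
    proof (rule inj_onI)
      fix z w assume "z \<in> ball (0::complex) r" "w \<in> ball 0 r" "\<psi> (of_real \<sigma> * z) = \<psi> (of_real \<sigma> * w)"
      then have "of_real \<sigma> * z = of_real \<sigma> * w"
        using inj_onD[OF \<psi>_inj] \<sigma>_ball by blast
      then show "z = w" using \<sigma>_sq(2) by metis
    qed
    have "((\<lambda>z. of_real t + of_real \<sigma> * z) has_field_derivative of_real \<sigma>) (at 0)"
      by (auto intro!: derivative_eq_intros)
    then have "((\<lambda>z. \<phi> (of_real t + of_real \<sigma> * z)) has_field_derivative deriv \<phi> (of_real t) * of_real \<sigma>) (at 0)"
      by (intro DERIV_chain2[of \<phi>]) (use \<phi>_der in auto)
    then show "((\<lambda>z. \<psi> (of_real \<sigma> * z)) has_field_derivative of_real \<sigma> * vector_derivative \<gamma> (at t)) (at 0)"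
      by (simp add: \<psi>_def deriv_eq mult.commute)
    fix x :: real assume "\<bar>x\<bar> < r"
    then have mem: "t + \<sigma> * x \<in> {t-r2..t+r2}"
      using \<sigma>(1) by (auto simp: r_def)
    then show "t + \<sigma> * x \<in> {t1<..<t2} \<and> \<psi> (of_real \<sigma> * of_real x) = \<gamma> (t + \<sigma> * x)"
      using subsetD[OF r2_sub mem] u_eq[OF mem] by (simp add: \<psi>_def u_def)
  next
    fix z :: complex assume z: "z \<in> ball 0 r"
    show "\<psi> (of_real \<sigma> * z) \<in> \<Omega> \<longleftrightarrow> 0 < Im z"
    proof (cases "Im z" "0 :: real" rule: linorder_cases)
      case less
      then have "- z \<in> U" using z by (simp add: U_def)
      \<comment> \<open>The argument \<open>\<sigma> * z\<close> is rewritten as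
        \<open>(-\<sigma>) * (-z)\<close> with \<open>-z\<close> in the upper half disc.\<close>
      then have "\<psi> (of_real (- \<sigma>) * (- z)) \<in> D (- \<sigma>)" unfolding D_def by blast
      then have "\<psi> (of_real \<sigma> * z) \<in> outside (path_image c)" using \<sigma>(3) by auto
      then have "\<psi> (of_real \<sigma> * z) \<notin> \<Omega>" using J \<Omega>_eq by blast
      then show ?thesis using less by simp
    next
      case equal
      then have "\<psi> (of_real \<sigma> * z) \<in> path_image c"
        using \<psi>_J[OF \<sigma>_ball[OF z]] by simp
      then have "\<psi> (of_real \<sigma> * z) \<notin> \<Omega>" using J \<Omega>_eq by blast
      then show ?thesis using equal by simp
    next
      case greater
      then have "z \<in> U" using z by (simp add: U_def)
      then have "\<psi> (of_real \<sigma> * z) \<in> D \<sigma>" unfolding D_def by blast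
      then show ?thesis using \<sigma>(2) greater \<Omega>_eq by auto
    qed
  qed
qed

section \<open>Functions of class \<open>C\<^sup>p\<close>\<close>

lemma nth_vector_derivative_0 [simp]: "nth_vector_derivative 0 g = g"
  by (simp add: nth_vector_derivative_def)

lemma nth_vector_derivative_Suc:
  "nth_vector_derivative (Suc l) g t = vector_derivative (nth_vector_derivative l g) (at t)"
  by (simp add: nth_vector_derivative_def)

text \<open>Here the innermost derivative is split off instead of the outermost, which is the form
  needed for recursion on the order of smoothness.\<close>

lemma nth_vector_derivative_Suc_shift:
  "nth_vector_derivative (Suc l) g = nth_vector_derivative l (\<lambda>t. vector_derivative g (at t))"
  by (simp add: nth_vector_derivative_def funpow_Suc_right del: funpow.simps)

lemma nth_vector_derivative_cong:
  assumes "open S" "\<And>t. t \<in> S \<Longrightarrow> f t = g t" "t \<in> S"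
  shows "nth_vector_derivative l f t = nth_vector_derivative l g t"
  using assms(3)
proof (induction l arbitrary: t)
  case (Suc l)
  have "\<forall>\<^sub>F x in nhds t. nth_vector_derivative l f x = nth_vector_derivative l g x"
    using eventually_nhds_in_open[OF assms(1) Suc.prems] by eventually_elim (rule Suc.IH)
  then show ?case
    by (auto simp: nth_vector_derivative_Suc intro: vector_derivative_cong_eq)
qed (simp add: assms(2))

lemma differentiable_cong_open:
  fixes f g :: "real \<Rightarrow> complex"
  assumes "open S" "\<And>t. t \<in> S \<Longrightarrow> f t = g t" "t \<in> S" "f differentiable (at t)"
  shows "g differentiable (at t)"
proof -
  obtain D where "(f has_derivative D) (at t)"
    using assms(4) unfolding differentiable_def by blast
  then have "(g has_derivative D) (at t)"
    by (rule has_derivative_transform_within_open[where s = S and g = g]) (use assms in auto)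
  then show ?thesis unfolding differentiable_def by blast
qed

lemma Cp_on_cong:
  assumes "open S" "\<And>t. t \<in> S \<Longrightarrow> f t = g t" "Cp_on p f S"
  shows "Cp_on p g S"
proof -
  note eq = nth_vector_derivative_cong[OF assms(1,2)]
  show ?thesis
    unfolding Cp_on_def
  proof (intro conjI allI impI ballI)
    fix l t assume "enat l < p" "t \<in> S"
    then show "nth_vector_derivative l g differentiable at t"
      using assms(3) unfolding Cp_on_def
      by (intro differentiable_cong_open[OF assms(1) eq]) auto
  next
    fix l assume "enat l \<le> p"
    then have "continuous_on S (nth_vector_derivative l f)"
      using assms(3) unfolding Cp_on_def by auto
    then show "continuous_on S (nth_vector_derivative l g)"
      using eq by (simp cong: continuous_on_cong)
  qed
qed

lemma Cp_on_mono: "Cp_on p g S \<Longrightarrow> q \<le> p \<Longrightarrow> Cp_on q g S"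
  unfolding Cp_on_def by (meson order_less_le_trans order_trans)

text \<open>This makes induction on a natural number available when \<open>p\<close> is infinite.
  Differentiability of the \<open>l\<close>-th derivative for \<open>l < p\<close> is read off from
  order \<open>Suc l\<close>.\<close>

lemma Cp_on_iff_finite: "Cp_on p g S \<longleftrightarrow> (\<forall>k. enat k \<le> p \<longrightarrow> Cp_on (enat k) g S)"
proof
  assume R: "\<forall>k. enat k \<le> p \<longrightarrow> Cp_on (enat k) g S"
  show "Cp_on p g S"
    unfolding Cp_on_def
  proof (intro conjI allI impI)
    fix l assume "enat l < p"
    then have "enat (Suc l) \<le> p" by (simp add: Suc_ile_eq)
    then show "\<forall>t\<in>S. nth_vector_derivative l g differentiable at t"
      using R unfolding Cp_on_def by auto
  next
    fix l assume "enat l \<le> p"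
    then show "continuous_on S (nth_vector_derivative l g)"
      using R unfolding Cp_on_def by auto
  qed
qed (blast intro: Cp_on_mono)

lemma Cp_on_0: "Cp_on (enat 0) g S \<longleftrightarrow> continuous_on S g"
  unfolding Cp_on_def by auto

lemma Cp_on_Suc:
  "Cp_on (enat (Suc k)) g S \<longleftrightarrow>
    (\<forall>t\<in>S. g differentiable (at t)) \<and> Cp_on (enat k) (\<lambda>t. vector_derivative g (at t)) S"
proof -
  have all_nat: "(\<forall>l. P l) \<longleftrightarrow> P 0 \<and> (\<forall>l. P (Suc l))" for P :: "nat \<Rightarrow> bool"
    by (metis not0_implies_Suc)
  \<comment> \<open>The order zero clause of \<open>Cp_on\<close> on the left has no counterpart on
    the right; it follows from differentiability.\<close>
  have cont: "continuous_on S g" if "\<forall>t\<in>S. g differentiable (at t)"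
    using that differentiable_imp_continuous_within
    by (intro continuous_at_imp_continuous_on) auto
  show ?thesis
    unfolding Cp_on_def all_nat[of "\<lambda>l. enat l < enat (Suc k) \<longrightarrow> _ l"]
      all_nat[of "\<lambda>l. enat l \<le> enat (Suc k) \<longrightarrow> _ l"] nth_vector_derivative_Suc_shift
    using cont by auto
qed

text \<open>Any formula \<open>g'\<close> for the derivative on \<open>S\<close> may be used, so
  that the explicit expressions of the differentiation rules can be inserted directly.\<close>

lemma Cp_on_SucI:
  assumes "\<And>t. t \<in> S \<Longrightarrow> (g has_vector_derivative g' t) (at t)" "open S" "Cp_on (enat k) g' S"
  shows "Cp_on (enat (Suc k)) g S"
  unfolding Cp_on_Suc
proof
  show "\<forall>t\<in>S. g differentiable (at t)"
    using assms(1) by (blast intro: differentiableI_vector)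
  show "Cp_on (enat k) (\<lambda>t. vector_derivative g (at t)) S"
    by (rule Cp_on_cong[OF assms(2) _ assms(3)]) (simp add: vector_derivative_at[OF assms(1)])
qed

lemma Cp_on_SucD:
  assumes "Cp_on (enat (Suc k)) g S" "t \<in> S"
  shows "(g has_vector_derivative vector_derivative g (at t)) (at t)"
  using assms unfolding Cp_on_Suc by (simp add: vector_derivative_works)

lemma Cp_on_Suc_le: "Cp_on (enat (Suc k)) g S \<Longrightarrow> Cp_on (enat k) g S"
  by (erule Cp_on_mono) simp

section \<open>Sums, products and reciprocals of functions of class \<open>C\<^sup>k\<close>\<close>

lemma Cp_on_add:
  assumes "open S" "Cp_on (enat k) f S" "Cp_on (enat k) g S"
  shows "Cp_on (enat k) (\<lambda>t. f t + g t) S"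
  using assms(2,3)
proof (induction k arbitrary: f g)
  case 0
  then show ?case by (simp add: Cp_on_0 continuous_on_add)
next
  case (Suc k)
  show ?case
  proof (rule Cp_on_SucI[OF _ assms(1)])
    show "((\<lambda>t. f t + g t) has_vector_derivative vector_derivative f (at t) + vector_derivative g (at t)) (at t)"
      if "t \<in> S" for t
      using that Suc.prems by (intro has_vector_derivative_add Cp_on_SucD)
    show "Cp_on (enat k) (\<lambda>t. vector_derivative f (at t) + vector_derivative g (at t)) S"
      using Suc.prems unfolding Cp_on_Suc by (intro Suc.IH) auto
  qed
qed

lemma Cp_on_mult:
  assumes "open S" "Cp_on (enat k) f S" "Cp_on (enat k) g S"
  shows "Cp_on (enat k) (\<lambda>t. f t * g t) S"
  using assms(2,3)
proof (induction k arbitrary: f g)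
  case 0
  then show ?case by (simp add: Cp_on_0 continuous_on_mult)
next
  case (Suc k)
  have f': "Cp_on (enat k) (\<lambda>t. vector_derivative f (at t)) S"
    and g': "Cp_on (enat k) (\<lambda>t. vector_derivative g (at t)) S"
    using Suc.prems by (auto simp: Cp_on_Suc)
  show ?case
  proof (rule Cp_on_SucI[OF _ assms(1)])
    show "((\<lambda>t. f t * g t) has_vector_derivative
        f t * vector_derivative g (at t) + vector_derivative f (at t) * g t) (at t)"
      if "t \<in> S" for t
      using that Suc.prems by (intro has_vector_derivative_mult Cp_on_SucD)
    show "Cp_on (enat k) (\<lambda>t. f t * vector_derivative g (at t) + vector_derivative f (at t) * g t) S"
      by (intro Cp_on_add[OF assms(1)] Suc.IH f' g' Suc.prems[THEN Cp_on_Suc_le])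
  qed
qed

lemma Cp_on_const: "open S \<Longrightarrow> Cp_on (enat k) (\<lambda>_. c) S"
proof (induction k arbitrary: c)
  case (Suc k)
  then show ?case
    by (intro Cp_on_SucI[of S _ "\<lambda>_. 0"]) (auto intro: has_vector_derivative_const)
qed (simp add: Cp_on_0)

text \<open>The derivative of \<open>1/f\<close> is built from \<open>f'\<close> and
  \<open>1/f\<close> itself, and \<open>1/f\<close> is already of the lower order \<open>k\<close>
  by the induction hypothesis.\<close>

lemma Cp_on_inverse:
  assumes "open S" "Cp_on (enat k) f S" "\<And>t. t \<in> S \<Longrightarrow> f t \<noteq> 0"
  shows "Cp_on (enat k) (\<lambda>t. inverse (f t)) S"
  using assms(2)
proof (induction k)
  case 0
  then show ?case using assms(3) by (auto simp: Cp_on_0 intro: continuous_on_inverse)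
next
  case (Suc k)
  have f': "Cp_on (enat k) (\<lambda>t. vector_derivative f (at t)) S"
    using Suc.prems by (simp add: Cp_on_Suc)
  have inv: "Cp_on (enat k) (\<lambda>t. inverse (f t)) S"
    by (rule Suc.IH[OF Cp_on_Suc_le[OF Suc.prems]])
  show ?case
  proof (rule Cp_on_SucI[OF _ assms(1)])
    \<comment> \<open>The derivative is written as a pure product with a constant factor -1, so that
      closure under products and constants applies to it.\<close>
    show "((\<lambda>t. inverse (f t)) has_vector_derivative
        vector_derivative f (at t) * (- 1 * (inverse (f t) * inverse (f t)))) (at t)"
      if "t \<in> S" for t
    proof -
      have "((inverse \<circ> f) has_vector_derivative vector_derivative f (at t) * - (inverse (f t) ^ Suc (Suc 0))) (at t)"
        using Cp_on_SucD[OF Suc.prems that] DERIV_inverse[OF assms(3)[OF that]]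
        by (rule field_vector_diff_chain_at)
      then show ?thesis by (simp add: o_def)
    qed
    show "Cp_on (enat k) (\<lambda>t. vector_derivative f (at t) * (- 1 * (inverse (f t) * inverse (f t)))) S"
      by (intro Cp_on_mult[OF assms(1)] Cp_on_const[OF assms(1)] f' inv)
  qed
qed

text \<open>Near each point the iterated real derivatives are the restrictions of the complex
  derivatives of the local holomorphic extension, which are differentiable at every order.\<close>

lemma Cp_on_real_analytic:
  assumes "real_analytic_on \<gamma> I" "S \<subseteq> interior I"
  shows "Cp_on p \<gamma> S"
proof -
  have main: "nth_vector_derivative l \<gamma> differentiable (at t)" if "t \<in> S" for l t
  proof -
    have t_int: "t \<in> interior I" using assms(2) that by blast
    obtain r \<phi> where "0 < r" and \<phi>_hol: "\<phi> holomorphic_on ball (of_real t) r"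
      and \<phi>: "\<And>s. \<bar>s - t\<bar> < r \<Longrightarrow> s \<in> I \<and> \<phi> (of_real s) = \<gamma> s"
      using real_analytic_on_complexify[OF assms(1) t_int] by metis
    have real_ball: "of_real s \<in> ball (complex_of_real t) r" if "s \<in> ball t r" for s
      using that by (simp add: dist_of_real)
    have chain: "((\<lambda>s. (deriv ^^ l) \<phi> (of_real s)) has_vector_derivative (deriv ^^ Suc l) \<phi> (of_real s)) (at s)"
      if "s \<in> ball t r" for l s
    proof -
      have "((deriv ^^ l) \<phi> has_field_derivative (deriv ^^ Suc l) \<phi> (of_real s)) (at (of_real s))"
        using holomorphic_derivI[OF holomorphic_higher_deriv[OF \<phi>_hol] _ real_ball[OF that]] by simp
      then show ?thesis by (rule has_vector_derivative_real_field)
    qed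
    have eq: "nth_vector_derivative l \<gamma> s = (deriv ^^ l) \<phi> (of_real s)" if "s \<in> ball t r" for l s
      using that
    proof (induction l arbitrary: s)
      case 0
      then show ?case using \<phi> by (simp add: dist_real_def abs_minus_commute)
    next
      case (Suc l)
      have "(nth_vector_derivative l \<gamma> has_vector_derivative (deriv ^^ Suc l) \<phi> (of_real s)) (at s)"
        by (rule has_vector_derivative_transform_within_open[OF chain[OF Suc.prems] open_ball Suc.prems])
          (simp add: Suc.IH)
      then show ?case
        unfolding nth_vector_derivative_Suc by (rule vector_derivative_at)
    qed
    have t: "t \<in> ball t r" using \<open>0 < r\<close> by simp
    have "(nth_vector_derivative l \<gamma> has_vector_derivative (deriv ^^ Suc l) \<phi> (of_real t)) (at t)"
      by (rule has_vector_derivative_transform_within_open[OF chain[OF t] open_ball t]) (simp add: eq)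
    then show ?thesis by (rule differentiableI_vector)
  qed
  then have "continuous_on S (nth_vector_derivative l \<gamma>)" for l
    by (intro continuous_at_imp_continuous_on ballI differentiable_imp_continuous_within)
  with main show ?thesis by (simp add: Cp_on_def)
qed

section \<open>Boundary derivatives along an analytic arc\<close>

text \<open>Only the geometry is fixed here, so that the lemmas apply alike to \<open>F\<close> and
  to each of its successive derivatives.\<close>

locale analytic_boundary_arc =
  fixes I :: "real set" and \<gamma> :: "real \<Rightarrow> complex" and t1 t2 :: real and \<Omega> :: "complex set"
  assumes interval: "is_interval I" "t1 \<in> I" "t2 \<in> I"
    and curve: "analytic_curve \<gamma> I"
    and domain: "jordan_domain \<Omega>"
    and arc: "\<gamma> ` {t1..t2} \<subseteq> frontier \<Omega>"
begin

abbreviation T :: "real set" where "T \<equiv> {t1<..<t2}"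

abbreviation A :: "complex set" where "A \<equiv> \<gamma> ` T"

lemma open_domain: "open \<Omega>"
  using domain Jordan_inside_outside unfolding jordan_domain_def by blast

lemma arc_point:
  assumes "t \<in> T"
  shows "\<gamma> t \<in> closure \<Omega>" "\<gamma> t \<notin> \<Omega>"
proof -
  have "\<gamma> t \<in> frontier \<Omega>" using arc assms by auto
  then show "\<gamma> t \<in> closure \<Omega>" "\<gamma> t \<notin> \<Omega>"
    using open_domain by (auto simp: frontier_def interior_open)
qed

lemma T_subset_interior: "T \<subseteq> interior I"
proof (rule interior_maximal)
  show "T \<subseteq> I" using mem_is_interval_1_I[OF interval] by auto
qed simp

lemma curve_derivative:
  assumes "t \<in> T"
  shows "(\<gamma> has_vector_derivative vector_derivative \<gamma> (at t)) (at t)" "vector_derivative \<gamma> (at t) \<noteq> 0"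
proof -
  have "Cp_on (enat (Suc 0)) \<gamma> T"
    using curve T_subset_interior unfolding analytic_curve_def by (blast intro: Cp_on_real_analytic)
  then show "(\<gamma> has_vector_derivative vector_derivative \<gamma> (at t)) (at t)"
    using assms by (rule Cp_on_SucD)
  have t: "t \<in> interior I" using assms T_subset_interior by blast
  then have "vector_derivative \<gamma> (at t within I) \<noteq> 0"
    using curve interior_subset unfolding analytic_curve_def by blast
  then show "vector_derivative \<gamma> (at t) \<noteq> 0"
    unfolding at_within_interior[OF t] .
qed

lemma Cp_on_curve_derivative: "Cp_on (enat k) (\<lambda>t. vector_derivative \<gamma> (at t)) T"
proof -
  have "Cp_on (enat (Suc k)) \<gamma> T"
    using curve T_subset_interior unfolding analytic_curve_def by (blast intro: Cp_on_real_analytic)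
  then show ?thesis by (simp add: Cp_on_Suc)
qed

lemma continuous_on_along_arc:
  assumes "continuous_on (\<Omega> \<union> A) G"
  shows "continuous_on T (\<lambda>t. G (\<gamma> t))"
proof (rule continuous_on_compose2[OF assms])
  show "continuous_on T \<gamma>"
    using curve_derivative(1) by (intro continuous_at_imp_continuous_on ballI has_vector_derivative_continuous)
qed auto

lemma continuous_extension_tendsto:
  assumes "continuous_extension \<Omega> (\<Omega> \<union> A) h G" "t \<in> T"
  shows "(h \<longlongrightarrow> G (\<gamma> t)) (at (\<gamma> t) within \<Omega>)"
proof -
  have "(G \<longlongrightarrow> G (\<gamma> t)) (at (\<gamma> t) within (\<Omega> \<union> A))"
    using assms by (auto simp: continuous_extension_def continuous_on_def)
  then have "(G \<longlongrightarrow> G (\<gamma> t)) (at (\<gamma> t) within \<Omega>)"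
    by (rule tendsto_within_subset) auto
  moreover have "\<forall>\<^sub>F z in at (\<gamma> t) within \<Omega>. G z = h z"
    using assms(1) by (simp add: continuous_extension_def eventually_at_filter)
  ultimately show ?thesis by (rule Lim_transform_eventually)
qed

text \<open>The target space is regular and \<open>\<Omega>\<close> is dense in
  \<open>\<Omega> \<union> A\<close>. Extending by pointwise limits from \<open>\<Omega>\<close> is
  therefore automatically continuous, also along the arc.\<close>

lemma continuous_extension_of_limits:
  assumes cont: "continuous_on \<Omega> h"
    and lim: "\<And>t. t \<in> T \<Longrightarrow> \<exists>L. (h \<longlongrightarrow> L) (at (\<gamma> t) within \<Omega>)"
  shows "\<exists>G. continuous_extension \<Omega> (\<Omega> \<union> A) h G"
proof (rule continuous_map_extension_pointwise_alt[of euclidean \<Omega> "\<Omega> \<union> A" euclidean h])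
  show "regular_space (euclidean :: complex topology)"
    by (simp add: metrizable_imp_regular_space metrizable_space_euclidean)
  show "\<Omega> \<union> A \<subseteq> euclidean closure_of \<Omega>"
    using arc_point(1) closure_subset[of \<Omega>] by auto
  have "atin_within euclidean z \<Omega> = at z within \<Omega>" for z
    by (auto simp: filter_eq_iff eventually_atin_within eventually_at_topological)
  then show "\<exists>l. limitin euclidean h l (atin_within euclidean z \<Omega>)" if "z \<in> \<Omega> \<union> A - \<Omega>" for z
    using lim that by auto
  show "continuous_map (top_of_set \<Omega>) euclidean h"
    using cont by simp
  fix G assume "continuous_map (top_of_set (\<Omega> \<union> A)) euclidean G" "\<And>x. x \<in> \<Omega> \<Longrightarrow> G x = h x"
  then show ?thesis
    by (auto simp: continuous_extension_def)
qed auto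

text \<open>The chart is recast in terms of filters: \<psi> and its local inverse \<kappa> transport
  limits between \<open>0\<close> in the half disc and \<open>\<gamma> t\<close> in
  \<open>\<Omega>\<close>. The image of \<psi> is open, so all points of \<open>\<Omega>\<close>
  close to \<open>\<gamma> t\<close> come from the half disc.\<close>

lemma boundary_chart:
  assumes "t \<in> T"
  obtains r \<psi> \<sigma> \<kappa> where "0 < r" "\<sigma> \<in> {1, -1 :: real}" "\<psi> holomorphic_on ball 0 r"
    "(\<psi> has_field_derivative of_real \<sigma> * vector_derivative \<gamma> (at t)) (at 0)"
    "\<forall>z\<in>ball 0 r. deriv \<psi> z \<noteq> 0"
    "\<forall>x. \<bar>x\<bar> < r \<longrightarrow> t + \<sigma> * x \<in> T \<and> \<psi> (of_real x) = \<gamma> (t + \<sigma> * x)"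
    "\<psi> ` upper_half_disc r \<subseteq> \<Omega>"
    "filterlim \<psi> (at (\<gamma> t) within \<Omega>) (at 0 within upper_half_disc r)"
    "filterlim \<kappa> (at 0 within upper_half_disc r) (at (\<gamma> t) within \<Omega>)"
    "\<forall>\<^sub>F w in at (\<gamma> t) within \<Omega>. \<kappa> w \<in> upper_half_disc r \<and> \<psi> (\<kappa> w) = w"
proof -
  obtain r \<psi> \<sigma> where r: "0 < r" and \<sigma>: "\<sigma> \<in> {1, -1 :: real}"
    and hol: "\<psi> holomorphic_on ball 0 r" and inj: "inj_on \<psi> (ball 0 r)"
    and der: "(\<psi> has_field_derivative of_real \<sigma> * vector_derivative \<gamma> (at t)) (at 0)"
    and real: "\<And>x. \<bar>x\<bar> < r \<Longrightarrow> t + \<sigma> * x \<in> T \<and> \<psi> (of_real x) = \<gamma> (t + \<sigma> * x)"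
    and side: "\<And>z. z \<in> ball 0 r \<Longrightarrow> \<psi> z \<in> \<Omega> \<longleftrightarrow> 0 < Im z"
    using analytic_curve_boundary_chart[OF interval curve domain arc assms] by metis
  have \<psi>0: "\<psi> 0 = \<gamma> t" using real[of 0] r by simp
  have cont: "continuous_on (ball 0 r) \<psi>"
    using hol by (rule holomorphic_on_imp_continuous_on)
  obtain \<kappa> where \<kappa>: "homeomorphism (ball 0 r) (\<psi> ` ball 0 r) \<psi> \<kappa>"
    using invariance_of_domain_homeomorphism[OF open_ball cont _ inj] by auto
  have \<psi>_open: "open (\<psi> ` ball 0 r)"
    by (rule open_mapping_thm3[OF hol open_ball inj])
  have t_in: "\<gamma> t \<in> \<psi> ` ball 0 r" using imageI[of 0 "ball 0 r" \<psi>] \<psi>0 r by simp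
  have ev: "\<forall>\<^sub>F w in at (\<gamma> t) within \<Omega>. \<kappa> w \<in> upper_half_disc r \<and> \<psi> (\<kappa> w) = w"
  proof -
    have "\<forall>\<^sub>F w in at (\<gamma> t) within \<Omega>. w \<in> \<psi> ` ball 0 r \<and> w \<in> \<Omega>"
      using eventually_nhds_in_open[OF \<psi>_open t_in] by (auto simp: eventually_at_filter elim: eventually_mono)
    then show ?thesis
    proof eventually_elim
      case (elim w)
      then have "\<psi> (\<kappa> w) = w" "\<kappa> w \<in> ball 0 r"
        using \<kappa> by (auto simp: homeomorphism_def)
      then show ?case using side[of "\<kappa> w"] elim by simp
    qed
  qed
  show thesis
  proof (rule that[OF r \<sigma> hol der _ _ _ _ _ ev])
    show "\<forall>z\<in>ball 0 r. deriv \<psi> z \<noteq> 0"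
      using holomorphic_injective_imp_regular[OF hol open_ball inj] by blast
    show "\<forall>x. \<bar>x\<bar> < r \<longrightarrow> t + \<sigma> * x \<in> T \<and> \<psi> (of_real x) = \<gamma> (t + \<sigma> * x)"
      using real by blast
    show sub: "\<psi> ` upper_half_disc r \<subseteq> \<Omega>"
      using side by auto
    have "isCont \<psi> 0" using der by (rule DERIV_isCont)
    then have "(\<psi> \<longlongrightarrow> \<gamma> t) (at 0 within upper_half_disc r)"
      unfolding isCont_def \<psi>0 by (rule tendsto_within_subset) simp
    \<comment> \<open>The target filter is punctured, so the value \<open>\<gamma> t\<close> has to
      be avoided; it lies on the frontier and not in the open set \<open>\<Omega>\<close>.\<close>
    moreover have "\<forall>\<^sub>F z in at 0 within upper_half_disc r. \<psi> z \<in> \<Omega> \<and> \<psi> z \<noteq> \<gamma> t"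
    proof -
      have "\<psi> z \<in> \<Omega> \<and> \<psi> z \<noteq> \<gamma> t" if "z \<in> upper_half_disc r" for z
      proof -
        have "\<psi> z \<in> \<Omega>" using imageI[OF that, of \<psi>] sub by (rule subsetD[rotated])
        then show ?thesis using arc_point(2)[OF assms] by metis
      qed
      then show ?thesis by (simp add: eventually_at_filter)
    qed
    ultimately show "filterlim \<psi> (at (\<gamma> t) within \<Omega>) (at 0 within upper_half_disc r)"
      by (simp add: filterlim_at)
    have "\<kappa> (\<gamma> t) = 0"
      using homeomorphism_apply1[OF \<kappa>, of 0] r \<psi>0 by simp
    moreover have "isCont \<kappa> (\<gamma> t)"
      using continuous_on_interior[OF homeomorphism_cont2[OF \<kappa>], of "\<gamma> t"] t_in
      unfolding interior_open[OF \<psi>_open] .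
    ultimately have "(\<kappa> \<longlongrightarrow> 0) (at (\<gamma> t) within \<Omega>)"
      unfolding isCont_def by (auto intro: tendsto_within_subset)
    moreover have "\<forall>\<^sub>F w in at (\<gamma> t) within \<Omega>. \<kappa> w \<in> upper_half_disc r \<and> \<kappa> w \<noteq> 0"
      using ev by eventually_elim auto
    ultimately show "filterlim \<kappa> (at 0 within upper_half_disc r) (at (\<gamma> t) within \<Omega>)"
      by (simp add: filterlim_at)
  qed
qed

section \<open>Transfer of one derivative between the half disc and the arc\<close>

lemma chart_pullback:
  assumes cont: "continuous_on (\<Omega> \<union> A) G" and hol: "G holomorphic_on \<Omega>"
    and \<psi>_hol: "\<psi> holomorphic_on ball 0 r"
    and real: "\<forall>x. \<bar>x\<bar> < r \<longrightarrow> t + \<sigma> * x \<in> T \<and> \<psi> (of_real x) = \<gamma> (t + \<sigma> * x)"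
    and sub: "\<psi> ` upper_half_disc r \<subseteq> \<Omega>"
  shows "continuous_on (ball 0 r \<inter> {z. 0 \<le> Im z}) (G \<circ> \<psi>)"
    and "(G \<circ> \<psi>) holomorphic_on upper_half_disc r"
    and "z \<in> upper_half_disc r \<Longrightarrow> deriv (G \<circ> \<psi>) z = deriv G (\<psi> z) * deriv \<psi> z"
proof -
  have "\<psi> ` (ball 0 r \<inter> {z. 0 \<le> Im z}) \<subseteq> \<Omega> \<union> A"
  proof clarify
    fix z :: complex assume z: "z \<in> ball 0 r" "0 \<le> Im z" "\<psi> z \<notin> A"
    show "\<psi> z \<in> \<Omega>"
    proof (cases "Im z = 0")
      case True
      then have "z = of_real (Re z)" by (simp add: complex_eq_iff)
      moreover have "\<bar>Re z\<bar> < r" using z(1) True by (simp add: cmod_eq_Re)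
      ultimately have "\<psi> z \<in> A" using real by (metis imageI)
      with z(3) show ?thesis by blast
    next
      case False
      then show ?thesis using z sub by force
    qed
  qed
  moreover have "continuous_on (ball 0 r \<inter> {z. 0 \<le> Im z}) \<psi>"
    using \<psi>_hol by (intro continuous_on_subset[OF holomorphic_on_imp_continuous_on]) auto
  ultimately show "continuous_on (ball 0 r \<inter> {z. 0 \<le> Im z}) (G \<circ> \<psi>)"
    using cont continuous_on_compose continuous_on_subset by blast
  have \<psi>_hol': "\<psi> holomorphic_on upper_half_disc r"
    using \<psi>_hol by (rule holomorphic_on_subset) auto
  then show "(G \<circ> \<psi>) holomorphic_on upper_half_disc r"
    using hol sub by (rule holomorphic_on_compose_gen)
  show "deriv (G \<circ> \<psi>) z = deriv G (\<psi> z) * deriv \<psi> z" if z: "z \<in> upper_half_disc r"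
  proof (rule deriv_chain)
    show "\<psi> field_differentiable at z"
      using holomorphic_on_imp_differentiable_at[OF \<psi>_hol' _ z] by simp
    show "G field_differentiable at (\<psi> z)"
      using holomorphic_on_imp_differentiable_at[OF hol open_domain] sub z by blast
  qed
qed

text \<open>The half disc result is applied to \<open>G \<circ> \<psi>\<close>, whose derivative
  tends to \<open>L * \<psi>'(0)\<close>. The sign \<sigma> enters once through \<psi>'(0) and once
  through the reparametrization, and its square is 1.\<close>

lemma has_vector_derivative_along_arc:
  assumes cont: "continuous_on (\<Omega> \<union> A) G" and hol: "G holomorphic_on \<Omega>" and t: "t \<in> T"
    and lim: "(deriv G \<longlongrightarrow> L) (at (\<gamma> t) within \<Omega>)"
  shows "((\<lambda>t. G (\<gamma> t)) has_vector_derivative L * vector_derivative \<gamma> (at t)) (at t)"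
proof -
  let ?\<gamma>' = "vector_derivative \<gamma> (at t)"
  obtain r \<psi> \<sigma> \<kappa> where r: "0 < r" and \<sigma>: "\<sigma> \<in> {1, -1 :: real}" and \<psi>_hol: "\<psi> holomorphic_on ball 0 r"
    and der: "(\<psi> has_field_derivative of_real \<sigma> * vector_derivative \<gamma> (at t)) (at 0)"
    and \<psi>_nz: "\<forall>z\<in>ball 0 r. deriv \<psi> z \<noteq> 0"
    and real: "\<forall>x. \<bar>x\<bar> < r \<longrightarrow> t + \<sigma> * x \<in> T \<and> \<psi> (of_real x) = \<gamma> (t + \<sigma> * x)"
    and sub: "\<psi> ` upper_half_disc r \<subseteq> \<Omega>"
    and \<psi>_lim: "filterlim \<psi> (at (\<gamma> t) within \<Omega>) (at 0 within upper_half_disc r)"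
    and \<kappa>_lim: "filterlim \<kappa> (at 0 within upper_half_disc r) (at (\<gamma> t) within \<Omega>)"
    and \<kappa>_ev: "\<forall>\<^sub>F w in at (\<gamma> t) within \<Omega>. \<kappa> w \<in> upper_half_disc r \<and> \<psi> (\<kappa> w) = w"
    by (rule boundary_chart[OF t])
  note pb = chart_pullback[OF cont hol \<psi>_hol real sub]
  have "isCont (deriv \<psi>) 0"
    using holomorphic_on_imp_continuous_on[OF holomorphic_deriv[OF \<psi>_hol open_ball]] r
    by (simp add: continuous_on_eq_continuous_at)
  then have "(deriv \<psi> \<longlongrightarrow> of_real \<sigma> * ?\<gamma>') (at 0)"
    using DERIV_imp_deriv[OF der] by (simp add: isCont_def)
  then have "(deriv \<psi> \<longlongrightarrow> of_real \<sigma> * ?\<gamma>') (at 0 within upper_half_disc r)"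
    by (rule tendsto_within_subset) simp
  then have "((\<lambda>z. deriv G (\<psi> z) * deriv \<psi> z) \<longlongrightarrow> L * (of_real \<sigma> * ?\<gamma>')) (at 0 within upper_half_disc r)"
    by (intro tendsto_mult filterlim_compose[OF lim \<psi>_lim])
  moreover have "\<forall>\<^sub>F z in at 0 within upper_half_disc r. deriv G (\<psi> z) * deriv \<psi> z = deriv (G \<circ> \<psi>) z"
    by (simp add: eventually_at_filter pb(3) del: o_apply)
  ultimately have "(deriv (G \<circ> \<psi>) \<longlongrightarrow> L * (of_real \<sigma> * ?\<gamma>')) (at 0 within upper_half_disc r)"
    by (rule Lim_transform_eventually)
  then have "((\<lambda>x. (G \<circ> \<psi>) (of_real x)) has_vector_derivative L * (of_real \<sigma> * ?\<gamma>')) (at 0)"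
    by (rule has_vector_derivative_of_deriv_limit[OF r pb(1,2)])
  then have at0: "((\<lambda>x. G (\<gamma> (t + \<sigma> * x))) has_vector_derivative L * (of_real \<sigma> * ?\<gamma>')) (at 0)"
    by (rule has_vector_derivative_transform_within_open[where S = "ball 0 r"])
      (use r real in auto)
  \<comment> \<open>Since \<sigma> is its own inverse, \<open>x = \<sigma> * (s - t)\<close> undoes
    the substitution \<open>s = t + \<sigma> * x\<close>.\<close>
  have "((\<lambda>s. \<sigma> * (s - t)) has_vector_derivative \<sigma>) (at t)"
    by (auto intro!: derivative_eq_intros)
  from vector_diff_chain_at[OF this, of "\<lambda>x. G (\<gamma> (t + \<sigma> * x))" "L * (of_real \<sigma> * ?\<gamma>')"] at0
  have "(((\<lambda>x. G (\<gamma> (t + \<sigma> * x))) \<circ> (\<lambda>s. \<sigma> * (s - t))) has_vector_derivative \<sigma> *\<^sub>R (L * (of_real \<sigma> * ?\<gamma>'))) (at t)"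
    by simp
  moreover have "(\<lambda>x. G (\<gamma> (t + \<sigma> * x))) \<circ> (\<lambda>s. \<sigma> * (s - t)) = (\<lambda>t. G (\<gamma> t))"
    using \<sigma> by auto
  moreover have "\<sigma> *\<^sub>R (L * (of_real \<sigma> * ?\<gamma>')) = L * ?\<gamma>'"
    using \<sigma> by auto
  ultimately show ?thesis by simp
qed

text \<open>On the real axis \<open>G \<circ> \<psi>\<close> is the given \<open>C\<^sup>1\<close>
  function up to the substitution \<open>t + \<sigma> * x\<close>, so its complex derivative has a
  limit at \<open>0\<close>. Division by the nonvanishing \<open>deriv \<psi>\<close> and
  composition with \<kappa> turn this into a limit of \<open>deriv G\<close>.\<close>

lemma deriv_limit_of_C1_along_arc:
  assumes cont: "continuous_on (\<Omega> \<union> A) G" and hol: "G holomorphic_on \<Omega>" and t: "t \<in> T"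
    and C1: "Cp_on (enat (Suc 0)) (\<lambda>t. G (\<gamma> t)) T"
  shows "\<exists>L. (deriv G \<longlongrightarrow> L) (at (\<gamma> t) within \<Omega>)"
proof -
  obtain r \<psi> \<sigma> \<kappa> where r: "0 < r" and \<sigma>: "\<sigma> \<in> {1, -1 :: real}" and \<psi>_hol: "\<psi> holomorphic_on ball 0 r"
    and der: "(\<psi> has_field_derivative of_real \<sigma> * vector_derivative \<gamma> (at t)) (at 0)"
    and \<psi>_nz: "\<forall>z\<in>ball 0 r. deriv \<psi> z \<noteq> 0"
    and real: "\<forall>x. \<bar>x\<bar> < r \<longrightarrow> t + \<sigma> * x \<in> T \<and> \<psi> (of_real x) = \<gamma> (t + \<sigma> * x)"
    and sub: "\<psi> ` upper_half_disc r \<subseteq> \<Omega>"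
    and \<psi>_lim: "filterlim \<psi> (at (\<gamma> t) within \<Omega>) (at 0 within upper_half_disc r)"
    and \<kappa>_lim: "filterlim \<kappa> (at 0 within upper_half_disc r) (at (\<gamma> t) within \<Omega>)"
    and \<kappa>_ev: "\<forall>\<^sub>F w in at (\<gamma> t) within \<Omega>. \<kappa> w \<in> upper_half_disc r \<and> \<psi> (\<kappa> w) = w"
    by (rule boundary_chart[OF t])
  note pb = chart_pullback[OF cont hol \<psi>_hol real sub]
  define g' where "g' t = vector_derivative (\<lambda>t. G (\<gamma> t)) (at t)" for t
  have g'_cont: "continuous_on T g'"
    using C1 unfolding Cp_on_Suc Cp_on_0 g'_def by blast
  have "\<exists>L. (deriv (G \<circ> \<psi>) \<longlongrightarrow> L) (at 0 within upper_half_disc r)"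
  proof (rule deriv_limit_of_C1_boundary_values[OF r pb(1,2), of "\<lambda>x. \<sigma> *\<^sub>R g' (t + \<sigma> * x)"])
    fix x assume x: "\<bar>x\<bar> < r"
    have "((\<lambda>x. t + \<sigma> * x) has_vector_derivative \<sigma>) (at x)"
      by (auto intro!: derivative_eq_intros)
    moreover have "((\<lambda>t. G (\<gamma> t)) has_vector_derivative g' (t + \<sigma> * x)) (at (t + \<sigma> * x))"
      unfolding g'_def using C1 x real by (intro Cp_on_SucD) auto
    ultimately have "((\<lambda>t. G (\<gamma> t)) \<circ> (\<lambda>x. t + \<sigma> * x) has_vector_derivative \<sigma> *\<^sub>R g' (t + \<sigma> * x)) (at x)"
      by (rule vector_diff_chain_at)
    then show "((\<lambda>x. (G \<circ> \<psi>) (of_real x)) has_vector_derivative \<sigma> *\<^sub>R g' (t + \<sigma> * x)) (at x)"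
      by (rule has_vector_derivative_transform_within_open[where S = "ball 0 r"])
        (use x real in auto)
  next
    have "continuous_on {-r<..<r} (\<lambda>x. g' (t + \<sigma> * x))"
      by (rule continuous_on_compose2[OF g'_cont]) (use real in \<open>auto intro!: continuous_intros simp: abs_less_iff\<close>)
    then show "continuous_on {-r<..<r} (\<lambda>x. \<sigma> *\<^sub>R g' (t + \<sigma> * x))"
      by (intro continuous_intros)
  qed
  then obtain L where "(deriv (G \<circ> \<psi>) \<longlongrightarrow> L) (at 0 within upper_half_disc r)" ..
  moreover have "(deriv \<psi> \<longlongrightarrow> deriv \<psi> 0) (at 0 within upper_half_disc r)"
  proof -
    have "isCont (deriv \<psi>) 0"
      using holomorphic_on_imp_continuous_on[OF holomorphic_deriv[OF \<psi>_hol open_ball]] r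
      by (simp add: continuous_on_eq_continuous_at)
    then show ?thesis
      unfolding isCont_def by (rule tendsto_within_subset) simp
  qed
  ultimately have "((\<lambda>z. deriv (G \<circ> \<psi>) z / deriv \<psi> z) \<longlongrightarrow> L / deriv \<psi> 0) (at 0 within upper_half_disc r)"
    using \<psi>_nz r by (intro tendsto_divide) auto
  then have "((\<lambda>w. deriv (G \<circ> \<psi>) (\<kappa> w) / deriv \<psi> (\<kappa> w)) \<longlongrightarrow> L / deriv \<psi> 0) (at (\<gamma> t) within \<Omega>)"
    by (rule filterlim_compose[OF _ \<kappa>_lim])
  moreover have "\<forall>\<^sub>F w in at (\<gamma> t) within \<Omega>. deriv (G \<circ> \<psi>) (\<kappa> w) / deriv \<psi> (\<kappa> w) = deriv G w"
    using \<kappa>_ev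
  proof eventually_elim
    case (elim w)
    then show ?case using pb(3)[of "\<kappa> w"] \<psi>_nz by simp
  qed
  ultimately have "(deriv G \<longlongrightarrow> L / deriv \<psi> 0) (at (\<gamma> t) within \<Omega>)"
    by (rule Lim_transform_eventually)
  then show ?thesis ..
qed

text \<open>The arc lemmas require one function that is holomorphic inside and continuous up to the
  arc. Replacing \<open>h\<close> by its extension \<open>G\<close> provides it without changing
  derivatives in \<open>\<Omega>\<close>.\<close>

lemma continuous_extension_holomorphic:
  assumes "continuous_extension \<Omega> (\<Omega> \<union> A) h G" "h holomorphic_on \<Omega>"
  shows "continuous_on (\<Omega> \<union> A) G" "G holomorphic_on \<Omega>" "\<And>z. z \<in> \<Omega> \<Longrightarrow> deriv G z = deriv h z"
proof -
  have eq: "\<And>z. z \<in> \<Omega> \<Longrightarrow> G z = h z"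
    using assms(1) by (simp add: continuous_extension_def)
  show "continuous_on (\<Omega> \<union> A) G"
    using assms(1) by (simp add: continuous_extension_def)
  show "G holomorphic_on \<Omega>"
    using assms(2) eq by (simp cong: holomorphic_cong)
  show "deriv G z = deriv h z" if "z \<in> \<Omega>" for z
    by (rule complex_derivative_transform_within_open[OF \<open>G holomorphic_on \<Omega>\<close> assms(2) open_domain that eq])
qed

text \<open>With \<open>h = F\<close> this is the derivative formula of the theorem; with higher
  derivatives for \<open>h\<close> it drives both inductions.\<close>

lemma deriv_extension_has_vector_derivative:
  assumes G: "continuous_extension \<Omega> (\<Omega> \<union> A) h G" and hol: "h holomorphic_on \<Omega>"
    and G': "continuous_extension \<Omega> (\<Omega> \<union> A) (deriv h) G'" and t: "t \<in> T"
  shows "((\<lambda>t. G (\<gamma> t)) has_vector_derivative G' (\<gamma> t) * vector_derivative \<gamma> (at t)) (at t)"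
proof (rule has_vector_derivative_along_arc[OF continuous_extension_holomorphic(1,2)[OF G hol] t])
  have "\<forall>\<^sub>F z in at (\<gamma> t) within \<Omega>. deriv h z = deriv G z"
    using continuous_extension_holomorphic(3)[OF G hol] by (simp add: eventually_at_filter)
  with continuous_extension_tendsto[OF G' t]
  show "(deriv G \<longlongrightarrow> G' (\<gamma> t)) (at (\<gamma> t) within \<Omega>)"
    by (rule Lim_transform_eventually)
qed

lemma deriv_extension_exists:
  assumes G: "continuous_extension \<Omega> (\<Omega> \<union> A) h G" and hol: "h holomorphic_on \<Omega>"
    and C1: "Cp_on (enat (Suc 0)) (\<lambda>t. G (\<gamma> t)) T"
  shows "\<exists>G'. continuous_extension \<Omega> (\<Omega> \<union> A) (deriv h) G'"
proof (rule continuous_extension_of_limits)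
  note ext = continuous_extension_holomorphic[OF G hol]
  show "continuous_on \<Omega> (deriv h)"
    by (intro holomorphic_on_imp_continuous_on holomorphic_deriv hol open_domain)
  fix t assume t: "t \<in> T"
  obtain L where "(deriv G \<longlongrightarrow> L) (at (\<gamma> t) within \<Omega>)"
    using deriv_limit_of_C1_along_arc[OF ext(1,2) t C1] by blast
  moreover have "\<forall>\<^sub>F z in at (\<gamma> t) within \<Omega>. deriv G z = deriv h z"
    using ext(3) by (simp add: eventually_at_filter)
  ultimately have "(deriv h \<longlongrightarrow> L) (at (\<gamma> t) within \<Omega>)"
    by (rule Lim_transform_eventually)
  then show "\<exists>L. (deriv h \<longlongrightarrow> L) (at (\<gamma> t) within \<Omega>)" ..
qed

text \<open>The induction carries the remaining smoothness of \<open>G\<close> along the arc. Each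
  step uses up one order, because the next extension along the arc is the derivative of
  \<open>G \<circ> \<gamma>\<close> divided by that of \<gamma>. Writing
  \<open>l + k \<le> p\<close> avoids subtraction and covers infinite \<open>p\<close>.\<close>

lemma Cp_on_imp_extensions:
  assumes G: "continuous_extension \<Omega> (\<Omega> \<union> A) F F" and hol: "F holomorphic_on \<Omega>"
    and Cp: "Cp_on p (\<lambda>t. F (\<gamma> t)) T" and l: "enat l \<le> p"
  shows "\<exists>G. continuous_extension \<Omega> (\<Omega> \<union> A) ((deriv ^^ l) F) G \<and>
    (\<forall>k. enat (l + k) \<le> p \<longrightarrow> Cp_on (enat k) (\<lambda>t. G (\<gamma> t)) T)"
  using l
proof (induction l)
  case 0
  then show ?case using G Cp_on_mono[OF Cp] by auto
next
  case (Suc l)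
  have hol_l: "(deriv ^^ l) F holomorphic_on \<Omega>"
    by (rule holomorphic_higher_deriv[OF hol open_domain])
  have "enat l \<le> p"
    using Suc.prems by (meson enat_ord_simps(1) le_SucI order_refl order_trans)
  from Suc.IH[OF this] obtain G where G: "continuous_extension \<Omega> (\<Omega> \<union> A) ((deriv ^^ l) F) G"
    and GCp: "\<And>k. enat (l + k) \<le> p \<Longrightarrow> Cp_on (enat k) (\<lambda>t. G (\<gamma> t)) T"
    by blast
  have "Cp_on (enat (Suc 0)) (\<lambda>t. G (\<gamma> t)) T"
    using Suc.prems by (intro GCp) simp
  from deriv_extension_exists[OF G hol_l this]
  obtain G' where G': "continuous_extension \<Omega> (\<Omega> \<union> A) (deriv ((deriv ^^ l) F)) G'"
    by blast
  have "Cp_on (enat k) (\<lambda>t. G' (\<gamma> t)) T" if k: "enat (Suc l + k) \<le> p" for k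
  proof -
    have "Cp_on (enat (Suc k)) (\<lambda>t. G (\<gamma> t)) T"
      using k by (intro GCp) simp
    then have "Cp_on (enat k) (\<lambda>t. vector_derivative (\<lambda>t. G (\<gamma> t)) (at t)) T"
      by (simp add: Cp_on_Suc)
    \<comment> \<open>This quotient is \<open>G' \<circ> \<gamma>\<close> by the derivative formula;
      the derivative of \<gamma> is smooth and never zero, so dividing by it costs no order.\<close>
    then have "Cp_on (enat k) (\<lambda>t. vector_derivative (\<lambda>t. G (\<gamma> t)) (at t) *
        inverse (vector_derivative \<gamma> (at t))) T"
      by (intro Cp_on_mult Cp_on_inverse Cp_on_curve_derivative curve_derivative(2)) auto
    then show ?thesis
    proof (rule Cp_on_cong[rotated 2])
      fix t assume t: "t \<in> T"
      show "vector_derivative (\<lambda>t. G (\<gamma> t)) (at t) * inverse (vector_derivative \<gamma> (at t)) = G' (\<gamma> t)"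
        using vector_derivative_at[OF deriv_extension_has_vector_derivative[OF G hol_l G' t]]
          curve_derivative(2)[OF t] by simp
    qed simp
  qed
  then show ?case using G' by auto
qed

text \<open>The derivative of \<open>G \<circ> \<gamma>\<close> is
  \<open>G' \<circ> \<gamma>\<close> times the derivative of \<gamma>, where \<open>G'\<close>
  extends the next complex derivative. Hence \<open>l\<close> and \<open>G\<close> vary in the
  induction on \<open>k\<close>: as \<open>k\<close> drops by one, \<open>l\<close> rises by
  one.\<close>

lemma extensions_imp_Cp_on:
  assumes hol: "F holomorphic_on \<Omega>"
    and ext: "\<And>l. enat l \<le> p \<Longrightarrow> \<exists>G. continuous_extension \<Omega> (\<Omega> \<union> A) ((deriv ^^ l) F) G"
    and G: "continuous_extension \<Omega> (\<Omega> \<union> A) ((deriv ^^ l) F) G" and k: "enat (l + k) \<le> p"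
  shows "Cp_on (enat k) (\<lambda>t. G (\<gamma> t)) T"
  using G k
proof (induction k arbitrary: l G)
  case 0
  then show ?case
    by (auto simp: Cp_on_0 continuous_extension_def intro: continuous_on_along_arc)
next
  case (Suc k)
  have hol_l: "(deriv ^^ l) F holomorphic_on \<Omega>"
    by (rule holomorphic_higher_deriv[OF hol open_domain])
  have "enat (Suc l) \<le> enat (l + Suc k)" by simp
  then have "enat (Suc l) \<le> p" using Suc.prems(2) by (rule order_trans)
  then obtain G' where G': "continuous_extension \<Omega> (\<Omega> \<union> A) ((deriv ^^ Suc l) F) G'"
    using ext by blast
  show ?case
  proof (rule Cp_on_SucI)
    show "((\<lambda>t. G (\<gamma> t)) has_vector_derivative G' (\<gamma> t) * vector_derivative \<gamma> (at t)) (at t)"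
      if "t \<in> T" for t
      using G' by (intro deriv_extension_has_vector_derivative[OF Suc.prems(1) hol_l _ that]) simp
    have "Cp_on (enat k) (\<lambda>t. G' (\<gamma> t)) T"
      using Suc.prems(2) by (intro Suc.IH[OF G']) simp
    then show "Cp_on (enat k) (\<lambda>t. G' (\<gamma> t) * vector_derivative \<gamma> (at t)) T"
      by (intro Cp_on_mult Cp_on_curve_derivative) auto
  qed simp
qed

end

theorem theorem4p2:
  fixes I :: "real set" and \<gamma> :: "real \<Rightarrow> complex" and f F :: "complex \<Rightarrow> complex"
    and t0 t1 t2 :: real and \<Omega> :: "complex set" and g :: "real \<Rightarrow> complex" and p :: enat
  assumes "is_interval I"
    and "analytic_curve \<gamma> I"
    and "locally_injective_on \<gamma> I"
    and "t0 \<in> interior I"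
    and "one_sided_extendable I \<gamma> f t0"
    and "one_sided_extension I \<gamma> f t0 \<Omega> t1 t2 F"
    and "t1 \<in> interior I" and "t2 \<in> interior I"
    and "\<forall>t\<in>{t1<..<t2}. g t = f (\<gamma> t)"
    and "1 \<le> p"
  shows "(Cp_on p g {t1<..<t2} \<longleftrightarrow>
           (\<forall>l::nat. enat l \<le> p \<longrightarrow>
              (\<exists>G. continuous_extension \<Omega> (\<Omega> \<union> \<gamma> ` {t1<..<t2}) ((deriv ^^ l) F) G))) \<and>
         (Cp_on p g {t1<..<t2} \<longrightarrow>
           (\<forall>G. continuous_extension \<Omega> (\<Omega> \<union> \<gamma> ` {t1<..<t2}) (deriv F) G \<longrightarrow>
              (\<forall>t\<in>{t1<..<t2}.
                 (g has_vector_derivative G (\<gamma> t) * vector_derivative \<gamma> (at t)) (at t))))"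
proof -
  have ose: "jordan_domain \<Omega>" "t1 \<in> I" "t2 \<in> I" "\<gamma> ` {t1..t2} \<subseteq> frontier \<Omega>"
    "continuous_on (\<Omega> \<union> \<gamma> ` {t1<..<t2}) F" "F holomorphic_on \<Omega>"
    "\<forall>z\<in>\<gamma> ` {t1<..<t2}. F z = f z"
    using assms(6) unfolding one_sided_extension_def by blast+
  interpret analytic_boundary_arc I \<gamma> t1 t2 \<Omega>
    using assms(1,2) ose by unfold_locales
  \<comment> \<open>Being continuous up to the arc, \<open>F\<close> is its own extension; this is
    the starting point of both inductions.\<close>
  have F: "continuous_extension \<Omega> (\<Omega> \<union> A) F F"
    using ose by (simp add: continuous_extension_def)
  have g_eq: "F (\<gamma> t) = g t" if "t \<in> T" for t
    using assms(9) ose(7) that by simp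
  have Cp_g: "Cp_on q g T \<longleftrightarrow> Cp_on q (\<lambda>t. F (\<gamma> t)) T" for q
    using Cp_on_cong[of T g "\<lambda>t. F (\<gamma> t)"] Cp_on_cong[of T "\<lambda>t. F (\<gamma> t)" g] g_eq by auto
  show ?thesis
  proof (intro conjI impI allI ballI iffI)
    fix l assume "Cp_on p g T" "enat l \<le> p"
    then show "\<exists>G. continuous_extension \<Omega> (\<Omega> \<union> A) ((deriv ^^ l) F) G"
      using Cp_on_imp_extensions[OF F ose(6)] Cp_g by blast
  next
    assume ext: "\<forall>l. enat l \<le> p \<longrightarrow> (\<exists>G. continuous_extension \<Omega> (\<Omega> \<union> A) ((deriv ^^ l) F) G)"
    \<comment> \<open>All finite orders are obtained from the case \<open>l = 0\<close> with
      \<open>G = F\<close>; together they give order \<open>p\<close>, also when \<open>p\<close> is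
      infinite.\<close>
    have "Cp_on (enat k) (\<lambda>t. F (\<gamma> t)) T" if "enat k \<le> p" for k
      using extensions_imp_Cp_on[OF ose(6), of p 0 F k] ext F that by simp
    then show "Cp_on p g T"
      unfolding Cp_g by (subst Cp_on_iff_finite) blast
  next
    fix G t assume G: "continuous_extension \<Omega> (\<Omega> \<union> A) (deriv F) G" and t: "t \<in> T"
    show "(g has_vector_derivative G (\<gamma> t) * vector_derivative \<gamma> (at t)) (at t)"
      by (rule has_vector_derivative_transform_within_open
          [OF deriv_extension_has_vector_derivative[OF F ose(6) G t] _ t g_eq]) simp_all
  qed
qed

end
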